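(* Assume scalar target signals ($d_s=1$). Let $P(z)=\sum_{k=-m}^mp_kz^{-k}$ and $Q(z)=\sum_{k=-m}^mq_kz^{-k}$ be Laurent polynomials of degree $m$ with real symmetric coefficients ($p_{-k}=p_k$, $q_{-k}=q_k$) satisfying $P(z)>0$, $Q(z)>0$ for all $z$ on the unit circle. Then the spectral factorization $U(z)^\ast U(z)=P(z)/Q(z)$ admits a rational factor $U(z)$. Furthermore, the filter $$K(z)=K_{H_2}(z)+U(z)^{-1}\big\{U(z)\{K_\circ(z)\Delta(z)\}_-\big\}_+\Delta(z)^{-1}$$ is rational and can be realized as a state-space filter $$\zeta_{t+1}=\widetilde{F}\zeta_t+\widetilde{G}y_t,\qquad \widehat{s}_t=\widetilde{H}\zeta_t+\widetilde{L}y_t,$$ with filter state $\zeta_t\in\mathbb{R}^{m+d_x}$, where $(\widetilde{F},\widetilde{G},\widetilde{H},\widetilde{L})$ are determined from $(A,B,C_y,C_s)$ and $U(z)$.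
   Context: State-space model: $x_{t+1}=Ax_t+Bw_t$, $y_t=C_yx_t+v_t$, $s_t=C_sx_t$ with $x_t\in\mathbb{R}^{d_x}$, $(A,C_y)$, $(A,C_s)$ detectable and $(A,B)$ controllable. Transfer functions $H(z)=C_y(zI-A)^{-1}B$, $L(z)=C_s(zI-A)^{-1}B$. $K_\circ(z)=L(z)H(z)^\ast(I+H(z)H(z)^\ast)^{-1}$ is the non-causal Wiener estimator. $\Delta(z)\Delta(z)^\ast=I+H(z)H(z)^\ast$ is the canonical spectral factorization ($\Delta,\Delta^{-1}$ causal). $\{\cdot\}_+$ and $\{\cdot\}_-$ denote the causal and strictly anti-causal parts of a transfer function (terms with nonpositive, resp. positive, powers of $z$ in its Laurent expansion on the unit circle). $K_{H_2}(z)=\{K_\circ(z)\Delta(z)\}_+\Delta(z)^{-1}$ is the Kalman filter. The spectral factor $U(z)$ is the canonical one ($U$ and $U^{-1}$ causal). *)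

theory Defs
  imports "HOL-Analysis.Analysis" "HOL-Computational_Algebra.Polynomial"
begin

definition cmat :: "real^'n^'m \<Rightarrow> complex^'n^'m" where
  "cmat M = (\<chi> i j. complex_of_real (M $ i $ j))"

definition cvec :: "real^'n \<Rightarrow> complex^'n" where
  "cvec v = (\<chi> i. complex_of_real (v $ i))"

definition adj :: "complex^'n^'m \<Rightarrow> complex^'m^'n" where
  "adj M = (\<chi> i j. cnj (M $ j $ i))"

fun matpow :: "real^'n^'n \<Rightarrow> nat \<Rightarrow> real^'n^'n" where
  "matpow M 0 = mat 1"
| "matpow M (Suc k) = M ** matpow M k"

definition schur_stable :: "real^'n^'n \<Rightarrow> bool" where
  "schur_stable M \<longleftrightarrow> (\<forall>z::complex. 1 \<le> cmod z \<longrightarrow> invertible (mat z - cmat M))"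

definition controllable :: "real^'n^'n \<Rightarrow> real^'w^'n \<Rightarrow> bool" where
  "controllable A B \<longleftrightarrow>
     span (\<Union>k\<in>{..<CARD('n)}. range (\<lambda>j. column j (matpow A k ** B))) = UNIV"

definition detectable :: "real^'n^'n \<Rightarrow> real^'n^'p \<Rightarrow> bool" where
  "detectable A C \<longleftrightarrow> (\<exists>G :: real^'p^'n. schur_stable (A - G ** C))"

definition detectable_row :: "real^'n^'n \<Rightarrow> real^'n \<Rightarrow> bool" where
  "detectable_row A c \<longleftrightarrow> (\<exists>g :: real^'n. schur_stable (A - (\<chi> i j. g $ i * c $ j)))"

definition lcoeff :: "(complex \<Rightarrow> complex) \<Rightarrow> int \<Rightarrow> complex" where
  "lcoeff f n = integral {0..2*pi} (\<lambda>\<theta>. f (cis \<theta>) * cis (- of_int n * \<theta>)) / complex_of_real (2*pi)"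

definition plus_part :: "(complex \<Rightarrow> complex) \<Rightarrow> complex \<Rightarrow> complex" where
  "plus_part f z = (\<Sum>k. lcoeff f (- int k) * z powi (- int k))"

definition minus_part :: "(complex \<Rightarrow> complex) \<Rightarrow> complex \<Rightarrow> complex" where
  "minus_part f z = (\<Sum>k. lcoeff f (int k + 1) * z ^ (k + 1))"

definition causal :: "(complex \<Rightarrow> complex) \<Rightarrow> bool" where
  "causal f \<longleftrightarrow> (\<forall>n::int. n > 0 \<longrightarrow> lcoeff f n = 0)"

definition ratfun :: "(complex \<Rightarrow> complex) \<Rightarrow> bool" where
  "ratfun f \<longleftrightarrow> (\<exists>a b :: complex poly. \<forall>z. cmod z = 1 \<longrightarrow>
      poly b z \<noteq> 0 \<and> f z = poly a z / poly b z)"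

definition vplus_part :: "(complex \<Rightarrow> complex^'n) \<Rightarrow> complex \<Rightarrow> complex^'n" where
  "vplus_part F z = (\<chi> j. plus_part (\<lambda>w. F w $ j) z)"

definition vminus_part :: "(complex \<Rightarrow> complex^'n) \<Rightarrow> complex \<Rightarrow> complex^'n" where
  "vminus_part F z = (\<chi> j. minus_part (\<lambda>w. F w $ j) z)"

definition vratfun :: "(complex \<Rightarrow> complex^'n) \<Rightarrow> bool" where
  "vratfun F \<longleftrightarrow> (\<forall>j. ratfun (\<lambda>w. F w $ j))"

definition mratfun :: "(complex \<Rightarrow> complex^'n^'m) \<Rightarrow> bool" where
  "mratfun F \<longleftrightarrow> (\<forall>i j. ratfun (\<lambda>w. F w $ i $ j))"

definition mcausal :: "(complex \<Rightarrow> complex^'n^'m) \<Rightarrow> bool" where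
  "mcausal F \<longleftrightarrow> (\<forall>i j. causal (\<lambda>w. F w $ i $ j))"

definition Htf :: "real^'n^'n \<Rightarrow> real^'w^'n \<Rightarrow> real^'n^'y \<Rightarrow> complex \<Rightarrow> complex^'w^'y" where
  "Htf A B Cy z = cmat Cy ** matrix_inv (mat z - cmat A) ** cmat B"

text \<open>L(z) = C_s (zI - A)^{-1} B, a row vector since d_s = 1.\<close>
definition Ltf :: "real^'n^'n \<Rightarrow> real^'w^'n \<Rightarrow> real^'n \<Rightarrow> complex \<Rightarrow> complex^'w" where
  "Ltf A B Cs z = (cvec Cs v* matrix_inv (mat z - cmat A)) v* cmat B"

definition Kwiener :: "real^'n^'n \<Rightarrow> real^'w^'n \<Rightarrow> real^'n^'y \<Rightarrow> real^'n \<Rightarrow> complex \<Rightarrow> complex^'y" where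
  "Kwiener A B Cy Cs z =
     (Ltf A B Cs z v* adj (Htf A B Cy z)) v*
        matrix_inv (mat 1 + Htf A B Cy z ** adj (Htf A B Cy z))"

definition canonical_Delta ::
  "real^'n^'n \<Rightarrow> real^'w^'n \<Rightarrow> real^'n^'y \<Rightarrow> (complex \<Rightarrow> complex^'y^'y) \<Rightarrow> bool" where
  "canonical_Delta A B Cy D \<longleftrightarrow>
     mratfun D \<and> mcausal D \<and> mcausal (\<lambda>z. matrix_inv (D z)) \<and>
     (\<forall>z. cmod z = 1 \<longrightarrow> D z ** adj (D z) = mat 1 + Htf A B Cy z ** adj (Htf A B Cy z))"

definition KH2 :: "real^'n^'n \<Rightarrow> real^'w^'n \<Rightarrow> real^'n^'y \<Rightarrow> real^'n \<Rightarrow>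
    (complex \<Rightarrow> complex^'y^'y) \<Rightarrow> complex \<Rightarrow> complex^'y" where
  "KH2 A B Cy Cs D z =
     vplus_part (\<lambda>w. Kwiener A B Cy Cs w v* D w) z v* matrix_inv (D z)"

definition Kfilt :: "real^'n^'n \<Rightarrow> real^'w^'n \<Rightarrow> real^'n^'y \<Rightarrow> real^'n \<Rightarrow>
    (complex \<Rightarrow> complex^'y^'y) \<Rightarrow> (complex \<Rightarrow> complex) \<Rightarrow> complex \<Rightarrow> complex^'y" where
  "Kfilt A B Cy Cs D U z =
     KH2 A B Cy Cs D z +
     (inverse (U z) *s
        vplus_part (\<lambda>w. U w *s vminus_part (\<lambda>u. Kwiener A B Cy Cs u v* D u) w) z)
       v* matrix_inv (D z)"

definition lpoly :: "(int \<Rightarrow> real) \<Rightarrow> nat \<Rightarrow> complex \<Rightarrow> complex" where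
  "lpoly p m z = (\<Sum>k\<in>{-int m..int m}. complex_of_real (p k) * z powi (- k))"

definition canonical_U :: "(int \<Rightarrow> real) \<Rightarrow> (int \<Rightarrow> real) \<Rightarrow> nat \<Rightarrow> (complex \<Rightarrow> complex) \<Rightarrow> bool" where
  "canonical_U p q m U \<longleftrightarrow>
     causal U \<and> causal (\<lambda>z. inverse (U z)) \<and>
     (\<forall>z. cmod z = 1 \<longrightarrow> cnj (U z) * U z = lpoly p m z / lpoly q m z)"

text \<open>Transfer function of the state-space filter
  zeta_{t+1} = F zeta_t + G y_t,  s_t = H zeta_t + L y_t:  L + H (zI - F)^{-1} G.\<close>
definition ss_tf :: "real^'r^'r \<Rightarrow> real^'y^'r \<Rightarrow> real^'r \<Rightarrow> real^'y \<Rightarrow> complex \<Rightarrow> complex^'y" where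
  "ss_tf F G H L z = cvec L + (cvec H v* matrix_inv (mat z - cmat F)) v* cmat G"

end

theory Submission
  imports Defs "HOL-Computational_Algebra.Fundamental_Theorem_Algebra"
begin

text \<open>
  On the unit circle the filter equals \<open>U\<^sup>-\<^sup>1 {U K\<^sub>0 D}\<^sub>+ D\<^sup>-\<^sup>1 = K\<^sub>0 - U\<^sup>-\<^sup>1 {U K\<^sub>0 D}\<^sub>- D\<^sup>-\<^sup>1\<close>, where \<open>K\<^sub>0\<close> is the
  Wiener estimator. Both \<open>K\<^sub>0\<close> and \<open>(I + H H\<^sup>*)\<^sup>-\<^sup>1\<close> arise from solving a linear system with the
  Hamiltonian pencil, whose determinant is a self-reciprocal polynomial of degree \<open>2 d\<^sub>x\<close> without roots on the
  circle; let \<open>a\<close> be its monic factor of degree \<open>d\<^sub>x\<close> with the roots in the open disc, and \<open>b\<close> the analogous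
  factor of \<open>z\<^sup>m P(z)\<close>. The first expression bounds the powers of \<open>z\<close> in the Fourier series of
  \<open>b a K\<close> by \<open>m + d\<^sub>x\<close>. In the second one the factors \<open>a K\<^sub>0\<close>, \<open>a D\<^sup>-\<^sup>1 = D\<^sup>* (a (I + H H\<^sup>*)\<^sup>-\<^sup>1)\<close> and
  \<open>b U\<^sup>-\<^sup>1 = U\<^sup>* (b Q / P)\<close> are anticausal, so no negative powers occur. Hence \<open>b a K\<close> is a polynomial vector
  of degree at most \<open>m + d\<^sub>x\<close>. Its coefficients are real, and as \<open>b a\<close> is a scalar common denominator, the
  observer companion form realizes the filter with \<open>m + d\<^sub>x\<close> states.
\<close>

section \<open>Absolutely convergent Fourier series\<close>

text \<open>The operators \<open>plus_part\<close> and \<open>minus_part\<close> are given by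
  Fourier integrals, and \<open>D\<close> and \<open>U\<close> are constrained only on the unit
  circle, so pole arguments and analytic continuation do not apply to them directly. Bookkeeping of
  exponents takes their place: products add exponent sets, and conjugation on the circle negates
  them. Causal means \<open>{..0}\<close>, strictly anticausal means \<open>{1..}\<close>, and
  exponents bounded on both sides leave a Laurent polynomial.

  The state count rests on two cancellations. The plant poles disappear because the pencil solves
  for the state instead of inverting \<open>zI - A\<close>; its determinant is the only denominator,
  and only the \<open>d_x\<close> inner roots of it obstruct anticausality. In
  \<open>inverse U\<close> the inner roots of \<open>P\<close> act as poles but those of
  \<open>Q\<close> as zeros, so \<open>Q\<close> contributes no state.\<close>

definition fourier_series :: "(int \<Rightarrow> complex) \<Rightarrow> (complex \<Rightarrow> complex) \<Rightarrow> bool" where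
  "fourier_series c f \<longleftrightarrow> (\<lambda>n. norm (c n)) summable_on UNIV \<and>
     (\<forall>z. cmod z = 1 \<longrightarrow> ((\<lambda>n. c n * z powi n) has_sum f z) UNIV)"

text \<open>The Wiener algebra with a bound on the support. \<open>S\<close> may exceed the actual
  set of exponents, so one notion covers membership (\<open>UNIV\<close>), causality and degree
  bounds.\<close>

definition wiener :: "int set \<Rightarrow> (complex \<Rightarrow> complex) \<Rightarrow> bool" where
  "wiener S f \<longleftrightarrow> (\<exists>c. fourier_series c f \<and> (\<forall>n. n \<notin> S \<longrightarrow> c n = 0))"

lemma unit_circle_inverse:
  assumes "cmod z = 1"
  shows "z \<noteq> 0" "inverse z = cnj z"
  using assms by (auto simp: divide_conv_cnj inverse_eq_divide)

lemma norm_unit_powi: "cmod z = 1 \<Longrightarrow> cmod (z powi n) = 1"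
  by (simp add: norm_power_int)

lemma cis_powi: "cis t powi n = cis (of_int n * t)"
  by (cases n rule: int_cases4)
     (auto simp: power_int_minus Complex.DeMoivre cis_inverse)

lemma integral_cis: "integral {0..2*pi} (\<lambda>t. cis (of_int n * t)) = (if n = 0 then complex_of_real (2*pi) else 0)"
proof (cases "n = 0")
  case False
  have "((\<lambda>t. cis (of_int n * t)) has_integral
      (cis (of_int n * (2*pi)) / (\<i> * of_int n) - cis (of_int n * 0) / (\<i> * of_int n))) {0..2*pi}"
  proof (rule fundamental_theorem_of_calculus)
    fix t :: real
    have "((\<lambda>t. cis (of_int n * t) / (\<i> * of_int n)) has_vector_derivative
        (of_int n *\<^sub>R (\<i> * cis (of_int n * t))) / (\<i> * of_int n)) (at t within {0..2*pi})"
      by (auto intro!: derivative_eq_intros simp: has_vector_derivative_def scaleR_conv_of_real field_simps)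
    thus "((\<lambda>t. cis (of_int n * t) / (\<i> * of_int n)) has_vector_derivative
        cis (of_int n * t)) (at t within {0..2*pi})"
      using False by (simp add: scaleR_conv_of_real)
  qed simp
  moreover have "cis (of_int n * (2*pi)) = 1"
    by (metis cis_multiple_2pi Ints_of_int mult.commute)
  ultimately have "((\<lambda>t. cis (of_int n * t)) has_integral 0) {0..2*pi}"
    by simp
  thus ?thesis using False by (simp add: integral_unique)
qed (simp add: scaleR_conv_of_real)

text \<open>Absolute summability gives uniform convergence by the M-test, hence termwise
  integration. This makes coefficients unique and ties the integrals behind
  \<open>plus_part\<close>, \<open>minus_part\<close> and \<open>causal\<close> to series.\<close>

lemma lcoeff_fourier_series:
  assumes "fourier_series c f"
  shows "lcoeff f n = c n"
proof -
  let ?g = "\<lambda>X t. \<Sum>k\<in>X. c k * cis t powi k * cis (- of_int n * t)"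
  have "uniform_limit {0..2*pi} ?g (\<lambda>t. f (cis t) * cis (- of_int n * t)) (finite_subsets_at_top UNIV)"
  proof (rule Weierstrass_m_test_general'[where M = "\<lambda>k. norm (c k)"])
    fix t :: real
    show "((\<lambda>k. c k * cis t powi k * cis (- of_int n * t)) has_sum f (cis t) * cis (- of_int n * t)) UNIV"
      using assms by (intro has_sum_cmult_left) (auto simp: fourier_series_def)
  qed (use assms in \<open>auto simp: fourier_series_def norm_mult norm_power_int\<close>)
  then obtain I J where I: "\<And>X. (?g X has_integral I X) {0..2*pi}"
     and J: "((\<lambda>t. f (cis t) * cis (- of_int n * t)) has_integral J) {0..2*pi}"
     and IJ: "(I \<longlongrightarrow> J) (finite_subsets_at_top UNIV)"
    by (rule uniform_limit_integral)
       (auto intro!: continuous_intros simp: cis_powi)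
  have g: "?g X = (\<lambda>t. \<Sum>k\<in>X. c k * cis (of_int (k - n) * t))" for X
    by (auto simp: cis_powi mult.assoc cis_mult algebra_simps intro!: sum.cong ext)
  \<comment> \<open>Every term but \<open>k = n\<close> integrates to zero, so the integral of a
    partial sum is constant once \<open>X\<close> contains \<open>n\<close>.\<close>
  have IX: "I X = 2 * pi * c n" if "finite X" "n \<in> X" for X
  proof -
    have "I X = integral {0..2*pi} (\<lambda>t. \<Sum>k\<in>X. c k * cis (of_int (k - n) * t))"
      using I[of X] unfolding g by (simp add: integral_unique)
    also have "\<dots> = (\<Sum>k\<in>X. integral {0..2*pi} (\<lambda>t. c k * cis (of_int (k - n) * t)))"
      using that by (intro integral_sum integrable_continuous_interval continuous_intros) auto
    also have "\<dots> = (\<Sum>k\<in>X. c k * integral {0..2*pi} (\<lambda>t. cis (of_int (k - n) * t)))"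
      by simp
    also have "\<dots> = (\<Sum>k\<in>X. if k = n then c k * (2 * pi) else 0)"
      unfolding integral_cis by (intro sum.cong) auto
    also have "\<dots> = 2 * pi * c n" using that by (simp add: mult.commute)
    finally show ?thesis .
  qed
  have "eventually (\<lambda>X. I X = 2 * pi * c n) (finite_subsets_at_top UNIV)"
    unfolding eventually_finite_subsets_at_top
    by (rule exI[of _ "{n}"]) (use IX in auto)
  with IJ have "((\<lambda>_ :: int set. 2 * pi * c n) \<longlongrightarrow> J) (finite_subsets_at_top UNIV)"
    by (rule Lim_transform_eventually)
  hence "J = 2 * pi * c n"
    by (metis tendsto_const tendsto_unique finite_subsets_at_top_neq_bot)
  thus ?thesis using J by (simp add: lcoeff_def integral_unique)
qed

lemma fourier_series_zero:
  assumes "fourier_series c f" "\<And>n. c n = 0" "cmod z = 1"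
  shows "f z = 0"
  using assms unfolding fourier_series_def
  by (metis (mono_tags, lifting) has_sum_0 has_sum_unique mult_zero_left)

text \<open>Uniqueness of coefficients in the role of a Liouville argument: what is both causal and
  strictly anticausal vanishes on the circle.\<close>

lemma wiener_zero:
  assumes "wiener S f" "wiener T f" "S \<inter> T = {}" "cmod z = 1"
  shows "f z = 0"
proof -
  obtain c d where c: "fourier_series c f" "\<And>n. n \<notin> S \<Longrightarrow> c n = 0"
    and d: "fourier_series d f" "\<And>n. n \<notin> T \<Longrightarrow> d n = 0"
    using assms by (auto simp: wiener_def)
  have "c n = d n" for n
    using lcoeff_fourier_series[OF c(1)] lcoeff_fourier_series[OF d(1)] by metis
  hence "c n = 0" for n using c(2) d(2) assms(3) by (metis disjoint_iff)
  thus ?thesis using fourier_series_zero[OF c(1)] assms(4) by blast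
qed

text \<open>Finitely many points of the circle correspond to a null set of angles.\<close>

lemma lcoeff_cong_finite:
  assumes "finite X" "\<And>z. cmod z = 1 \<Longrightarrow> z \<notin> X \<Longrightarrow> f z = g z"
  shows "lcoeff f n = lcoeff g n"
proof -
  \<comment> \<open>\<open>cis\<close> takes the same value at both ends of the interval of
    integration, hence the half-open interval; the angle \<open>2*pi\<close> is added to the
    exceptional set separately.\<close>
  have inj: "inj_on cis {0..<2*pi}"
  proof (rule inj_onI)
    fix s t :: real assume st: "s \<in> {0..<2*pi}" "t \<in> {0..<2*pi}" "cis s = cis t"
    then obtain k :: int where k: "s = t + 2 * pi * k"
      using sin_cos_eq_iff[of s t] by (auto simp: complex_eq_iff)
    have "\<bar>2 * pi * k\<bar> < 2 * pi" using st k by auto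
    hence "k = 0" by (simp add: abs_mult)
    thus "s = t" using k by simp
  qed
  have "finite (insert (2*pi) (cis -` X \<inter> {0..<2*pi}))"
    using finite_vimage_IntI[OF assms(1) inj] by simp
  moreover have "{t\<in>{0..2*pi}. cis t \<in> X} \<subseteq> insert (2*pi) (cis -` X \<inter> {0..<2*pi})"
    by auto
  ultimately have neg: "negligible {t\<in>{0..2*pi}. cis t \<in> X}"
    using finite_subset negligible_finite by blast
  have "integral {0..2*pi} (\<lambda>\<theta>. f (cis \<theta>) * cis (- of_int n * \<theta>)) =
     integral {0..2*pi} (\<lambda>\<theta>. g (cis \<theta>) * cis (- of_int n * \<theta>))"
  proof (rule integral_spike[OF neg])
    fix t :: real assume "t \<in> {0..2*pi} - {t\<in>{0..2*pi}. cis t \<in> X}"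
    hence "g (cis t) = f (cis t)" using assms(2)[of "cis t"] by simp
    thus "g (cis t) * cis (- of_int n * t) = f (cis t) * cis (- of_int n * t)" by simp
  qed
  thus ?thesis by (simp add: lcoeff_def)
qed

text \<open>A series is determined by its coefficients, which are blind to finitely many points.
  This carries identities across eigenvalues of \<open>A\<close> on the circle, where
  \<open>matrix_inv\<close> returns an arbitrary value.\<close>

lemma wiener_eqI_finite:
  assumes "wiener S f" "wiener T g" "finite X" "\<And>z. cmod z = 1 \<Longrightarrow> z \<notin> X \<Longrightarrow> f z = g z" "cmod z = 1"
  shows "f z = g z"
proof -
  obtain c d where c: "fourier_series c f" and d: "fourier_series d g"
    using assms by (auto simp: wiener_def)
  have "lcoeff f n = lcoeff g n" for n
    by (rule lcoeff_cong_finite[OF assms(3)]) (rule assms(4))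
  hence "c n = d n" for n
    by (simp add: lcoeff_fourier_series[OF c] lcoeff_fourier_series[OF d])
  hence "((\<lambda>n. c n * z powi n) has_sum f z) UNIV" "((\<lambda>n. c n * z powi n) has_sum g z) UNIV"
    using c d \<open>cmod z = 1\<close> by (auto simp: fourier_series_def)
  thus ?thesis by (rule has_sum_unique)
qed

lemma wiener_mono: "wiener S f \<Longrightarrow> S \<subseteq> T \<Longrightarrow> wiener T f"
  by (auto simp: wiener_def)

lemma wiener_cong:
  assumes "wiener S f" "\<And>z. cmod z = 1 \<Longrightarrow> f z = g z"
  shows "wiener S g"
  using assms by (force simp: wiener_def fourier_series_def)

lemma wiener_add:
  assumes "wiener S f" "wiener S g"
  shows "wiener S (\<lambda>z. f z + g z)"
proof -
  obtain c d where c: "fourier_series c f" "\<And>n. n \<notin> S \<Longrightarrow> c n = 0"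
    and d: "fourier_series d g" "\<And>n. n \<notin> S \<Longrightarrow> d n = 0"
    using assms by (auto simp: wiener_def)
  have "fourier_series (\<lambda>n. c n + d n) (\<lambda>z. f z + g z)"
    unfolding fourier_series_def
  proof (intro conjI allI impI)
    show "(\<lambda>n. cmod (c n + d n)) summable_on UNIV"
      by (rule Infinite_Sum.abs_summable_on_comparison_test'[where g = "\<lambda>n. cmod (c n) + cmod (d n)"])
         (use c d in \<open>auto simp: fourier_series_def norm_triangle_ineq intro!: summable_on_add\<close>)
    fix z :: complex assume "cmod z = 1"
    thus "((\<lambda>n. (c n + d n) * z powi n) has_sum f z + g z) UNIV"
      unfolding distrib_right using c d by (intro has_sum_add) (auto simp: fourier_series_def)
  qed
  thus ?thesis using c(2) d(2) by (force simp: wiener_def)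
qed

lemma wiener_0: "wiener S (\<lambda>_. 0)"
  unfolding wiener_def fourier_series_def by (rule exI[of _ "\<lambda>_. 0"]) auto

lemma wiener_sum:
  assumes "\<And>i. i \<in> I \<Longrightarrow> wiener S (f i)"
  shows "wiener S (\<lambda>z. \<Sum>i\<in>I. f i z)"
  using assms by (induction I rule: infinite_finite_induct) (auto intro: wiener_add wiener_0)

text \<open>Cauchy product over the integers: the double series converges absolutely, so it may be
  regrouped along \<open>k + l = n\<close> by passing from \<open>(k, l)\<close> to
  \<open>(k + l, k)\<close>.\<close>

lemma wiener_mult:
  assumes "wiener S f" "wiener T g" "\<And>s t. s \<in> S \<Longrightarrow> t \<in> T \<Longrightarrow> s + t \<in> R"
  shows "wiener R (\<lambda>z. f z * g z)"
proof -
  obtain c d where c: "fourier_series c f" "\<And>n. n \<notin> S \<Longrightarrow> c n = 0"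
    and d: "fourier_series d g" "\<And>n. n \<notin> T \<Longrightarrow> d n = 0"
    using assms(1,2) by (auto simp: wiener_def)
  define e where "e n = (\<Sum>\<^sub>\<infinity>k. c k * d (n - k))" for n
  have sc: "(\<lambda>n. norm (c n)) summable_on UNIV" and sd: "(\<lambda>n. norm (d n)) summable_on UNIV"
    using c(1) d(1) by (auto simp: fourier_series_def)
  have "(\<lambda>x. norm (case x of (k,l) \<Rightarrow> c k * d l)) summable_on UNIV \<times> UNIV"
    unfolding Infinite_Sum.abs_summable_on_Sigma_iff
    using sc sd by (auto simp: norm_mult infsum_cmult_right' infsum_nonneg intro!: summable_on_cmult_right summable_on_cmult_left)
  also have "?this \<longleftrightarrow> (\<lambda>x. norm (case x of (n,k) \<Rightarrow> c k * d (n - k))) summable_on UNIV \<times> UNIV"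
    by (rule summable_on_reindex_bij_witness[of _ "\<lambda>(n,k). (k, n - k)" "\<lambda>(k,l). (k + l, k)"]) auto
  finally have s2: "(\<lambda>x. norm (case x of (n,k) \<Rightarrow> c k * d (n - k))) summable_on UNIV \<times> UNIV" .
  have s3: "(\<lambda>k. norm (c k * d (n - k))) summable_on UNIV" for n
    using s2 unfolding Infinite_Sum.abs_summable_on_Sigma_iff by auto
  have s4: "(\<lambda>n. \<Sum>\<^sub>\<infinity>k. norm (c k * d (n - k))) summable_on UNIV"
    using s2 unfolding Infinite_Sum.abs_summable_on_Sigma_iff by (auto simp: infsum_nonneg)
  have "fourier_series e (\<lambda>z. f z * g z)"
    unfolding fourier_series_def
  proof (intro conjI allI impI)
    show "(\<lambda>n. cmod (e n)) summable_on UNIV"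
      by (rule Infinite_Sum.abs_summable_on_comparison_test'[OF s4]) (auto simp: e_def intro!: norm_infsum_bound s3)
    fix z :: complex assume z: "cmod z = 1"
    hence z0: "z \<noteq> 0" by auto
    have zp: "z powi k * z powi (n - k) = z powi n" for k n
      using z0 by (simp flip: power_int_add)
    have "((\<lambda>(k,l). (c k * z powi k) * (d l * z powi l)) has_sum f z * g z) (UNIV \<times> UNIV)"
    proof (rule has_sum_SigmaI[where g = "\<lambda>k. c k * z powi k * g z"])
      show "((\<lambda>l. case (k, l) of (k, l) \<Rightarrow> c k * z powi k * (d l * z powi l)) has_sum c k * z powi k * g z) UNIV" for k
        using d z by (auto simp: fourier_series_def intro!: has_sum_cmult_right)
      show "((\<lambda>k. c k * z powi k * g z) has_sum f z * g z) UNIV"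
        using c z by (auto simp: fourier_series_def intro!: has_sum_cmult_left)
      show "(\<lambda>(k, l). c k * z powi k * (d l * z powi l)) summable_on UNIV \<times> UNIV"
        by (rule abs_summable_summable, unfold Infinite_Sum.abs_summable_on_Sigma_iff)
           (use sc sd z in \<open>auto simp: norm_mult norm_unit_powi infsum_cmult_right' infsum_nonneg intro!: summable_on_cmult_right summable_on_cmult_left\<close>)
    qed
    also have "?this \<longleftrightarrow> ((\<lambda>(n,k). c k * d (n - k) * z powi n) has_sum f z * g z) (UNIV \<times> UNIV)"
      by (rule has_sum_reindex_bij_witness[of _ "\<lambda>(n,k). (k, n - k)" "\<lambda>(k,l). (k + l, k)"])
         (use z0 in \<open>auto simp: power_int_add algebra_simps\<close>)
    finally show "((\<lambda>n. e n * z powi n) has_sum f z * g z) UNIV"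
      by (rule has_sum_SigmaD)
         (auto simp: e_def intro!: has_sum_cmult_left has_sum_infsum abs_summable_summable s3)
  qed
  moreover have "e n = 0" if "n \<notin> R" for n
  proof -
    have "c k * d (n - k) = 0" for k
      using assms(3)[of k "n - k"] that c(2)[of k] d(2)[of "n - k"] by force
    hence "(\<lambda>k. c k * d (n - k)) = (\<lambda>_. 0)" by blast
    thus ?thesis by (simp add: e_def)
  qed
  ultimately show ?thesis by (auto simp: wiener_def)
qed

lemma wiener_powi: "n \<in> S \<Longrightarrow> wiener S (\<lambda>z. z powi n)"
  unfolding wiener_def fourier_series_def
proof (intro exI[of _ "\<lambda>k. if k = n then 1 else 0"] conjI allI impI)
  show "(\<lambda>k. cmod (if k = n then 1 else 0)) summable_on UNIV"
    by (rule finite_nonzero_values_imp_summable_on) auto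
  show "((\<lambda>k. (if k = n then 1 else 0) * z powi k) has_sum z powi n) UNIV" for z :: complex
    by (rule has_sum_finite_neutralI[of "{n}"]) auto
qed auto

lemma wiener_const: "0 \<in> S \<Longrightarrow> wiener S (\<lambda>_. a)"
  unfolding wiener_def fourier_series_def
proof (intro exI[of _ "\<lambda>k. if k = 0 then a else 0"] conjI allI impI)
  show "(\<lambda>k. cmod (if k = 0 then a else 0)) summable_on UNIV"
    by (rule finite_nonzero_values_imp_summable_on) auto
  show "((\<lambda>k. (if k = 0 then a else 0) * z powi k) has_sum a) UNIV" for z :: complex
    by (rule has_sum_finite_neutralI[of "{0}"]) auto
qed auto

lemma wiener_cmult: "wiener S f \<Longrightarrow> wiener S (\<lambda>z. a * f z)"
  by (rule wiener_mult[OF wiener_const[of "{0}"]]) auto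

lemma wiener_uminus: "wiener S f \<Longrightarrow> wiener S (\<lambda>z. - f z)"
  using wiener_cmult[of S f "-1"] by simp

lemma wiener_diff: "wiener S f \<Longrightarrow> wiener S g \<Longrightarrow> wiener S (\<lambda>z. f z - g z)"
  using wiener_add[OF _ wiener_uminus[of S g], of f] by simp

text \<open>On the circle \<open>cnj z = inverse z\<close>, so conjugation reverses exponents; this
  is how the adjoint of a causal factor becomes anticausal.\<close>

lemma wiener_cnj:
  assumes "wiener S f" "uminus ` S \<subseteq> T"
  shows "wiener T (\<lambda>z. cnj (f z))"
proof -
  obtain c where c: "fourier_series c f" "\<And>n. n \<notin> S \<Longrightarrow> c n = 0"
    using assms by (auto simp: wiener_def)
  have "fourier_series (\<lambda>n. cnj (c (- n))) (\<lambda>z. cnj (f z))"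
    unfolding fourier_series_def
  proof (intro conjI allI impI)
    have "(\<lambda>n. cmod (c n)) summable_on UNIV" using c by (auto simp: fourier_series_def)
    also have "?this \<longleftrightarrow> (\<lambda>n. cmod (cnj (c (- n)))) summable_on UNIV"
      by (rule summable_on_reindex_bij_witness[of _ uminus uminus]) auto
    finally show "(\<lambda>n. cmod (cnj (c (- n)))) summable_on UNIV" .
    fix z :: complex assume z: "cmod z = 1"
    hence cz: "cnj z = inverse z" by (simp add: unit_circle_inverse)
    have "((\<lambda>n. cnj (c n * z powi n)) has_sum cnj (f z)) UNIV"
      using c z by (simp add: fourier_series_def del: complex_cnj_mult)
    also have "?this \<longleftrightarrow> ((\<lambda>n. cnj (c (- n)) * z powi n) has_sum cnj (f z)) UNIV"
      by (rule has_sum_reindex_bij_witness[of _ uminus uminus])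
         (auto simp: cz power_int_minus power_int_inverse complex_cnj_power_int)
    finally show "((\<lambda>n. cnj (c (- n)) * z powi n) has_sum cnj (f z)) UNIV" .
  qed
  moreover have "cnj (c (- n)) = 0" if "n \<notin> T" for n
  proof -
    have "- n \<notin> S" using that assms(2) by force
    thus ?thesis using c(2) by simp
  qed
  ultimately show ?thesis unfolding wiener_def by blast
qed

text \<open>The two conjugations cancel on powers of \<open>z\<close> and merely conjugate the
  coefficients. Invariance under this map means real coefficients.\<close>

lemma wiener_cnj_reflect:
  assumes "wiener S f"
  shows "wiener S (\<lambda>z. cnj (f (cnj z)))"
proof -
  obtain c where c: "fourier_series c f" "\<And>n. n \<notin> S \<Longrightarrow> c n = 0"
    using assms by (auto simp: wiener_def)
  have "((\<lambda>n. cnj (c n) * z powi n) has_sum cnj (f (cnj z))) UNIV" if "cmod z = 1" for z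
  proof -
    have "((\<lambda>n. cnj (c n * cnj z powi n)) has_sum cnj (f (cnj z))) UNIV"
      using c that by (simp add: fourier_series_def del: complex_cnj_mult)
    thus ?thesis by (simp add: complex_cnj_power_int)
  qed
  hence "fourier_series (\<lambda>n. cnj (c n)) (\<lambda>z. cnj (f (cnj z)))"
    using c(1) by (simp add: fourier_series_def)
  thus ?thesis unfolding wiener_def using c(2) by (metis complex_cnj_zero)
qed

section \<open>Causality, causal and strictly anticausal parts\<close>

lemma wiener_causal:
  assumes "wiener S f" "causal f"
  shows "wiener {..0} f"
  using assms lcoeff_fourier_series unfolding wiener_def causal_def
  by (metis atMost_iff not_le)

lemma causal_wiener: "wiener {..0} f \<Longrightarrow> causal f"
  using lcoeff_fourier_series unfolding wiener_def causal_def
  by (metis atMost_iff not_le)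

text \<open>Absolute summability passes to subfamilies, so truncating the exponents stays in the
  class; for merely continuous functions this would fail.\<close>

lemma fourier_series_restrict:
  assumes "fourier_series c f"
  shows "\<exists>g. fourier_series (\<lambda>n. if n \<in> S then c n else 0) g"
proof -
  let ?d = "\<lambda>n. if n \<in> S then c n else 0"
  have s: "(\<lambda>n. norm (?d n)) summable_on UNIV"
    by (rule Infinite_Sum.abs_summable_on_comparison_test'[where g = "\<lambda>n. norm (c n)"])
       (use assms in \<open>auto simp: fourier_series_def\<close>)
  have "fourier_series ?d (\<lambda>z. \<Sum>\<^sub>\<infinity>n. ?d n * z powi n)"
    unfolding fourier_series_def
  proof (intro conjI allI impI s)
    fix z :: complex assume "cmod z = 1"
    hence "cmod (?d n * z powi n) = cmod (?d n)" for n
      by (simp add: norm_mult norm_unit_powi)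
    hence "(\<lambda>n. norm (?d n * z powi n)) summable_on UNIV"
      using s by presburger
    hence "(\<lambda>n. ?d n * z powi n) summable_on UNIV"
      by (rule abs_summable_summable)
    thus "((\<lambda>n. ?d n * z powi n) has_sum (\<Sum>\<^sub>\<infinity>n. ?d n * z powi n)) UNIV"
      by (rule has_sum_infsum)
  qed
  thus ?thesis by blast
qed

lemma plus_part_series:
  assumes "fourier_series c f"
  shows "fourier_series (\<lambda>n. if n \<in> {..0} then c n else 0) (plus_part f)"
proof -
  obtain g where g: "fourier_series (\<lambda>n. if n \<in> {..0} then c n else 0) g"
    using fourier_series_restrict[OF assms] by blast
  have "plus_part f z = g z" if "cmod z = 1" for z
  proof -
    have "((\<lambda>n. (if n \<in> {..0} then c n else 0) * z powi n) has_sum g z) UNIV"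
      using g that by (simp add: fourier_series_def)
    also have "?this \<longleftrightarrow> ((\<lambda>n. c n * z powi n) has_sum g z) {..0}"
      by (rule has_sum_cong_neutral) auto
    also have "\<dots> \<longleftrightarrow> ((\<lambda>k. c (- int k) * z powi (- int k)) has_sum g z) UNIV"
      by (rule has_sum_reindex_bij_witness[of _ "\<lambda>k. - int k" "\<lambda>n. nat (- n)"]) auto
    finally show ?thesis
      unfolding plus_part_def lcoeff_fourier_series[OF assms]
      by (metis has_sum_imp_sums sums_unique)
  qed
  thus ?thesis using g by (simp add: fourier_series_def)
qed

lemma minus_part_series:
  assumes "fourier_series c f"
  shows "fourier_series (\<lambda>n. if n \<in> {1..} then c n else 0) (minus_part f)"
proof -
  obtain g where g: "fourier_series (\<lambda>n. if n \<in> {1..} then c n else 0) g"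
    using fourier_series_restrict[OF assms] by blast
  have "minus_part f z = g z" if "cmod z = 1" for z
  proof -
    have "((\<lambda>n. (if n \<in> {1..} then c n else 0) * z powi n) has_sum g z) UNIV"
      using g that by (simp add: fourier_series_def)
    also have "?this \<longleftrightarrow> ((\<lambda>n. c n * z powi n) has_sum g z) {1..}"
      by (rule has_sum_cong_neutral) auto
    also have "\<dots> \<longleftrightarrow> ((\<lambda>k. c (int k + 1) * z ^ (k + 1)) has_sum g z) UNIV"
      by (rule has_sum_reindex_bij_witness[of _ "\<lambda>k. int k + 1" "\<lambda>n. nat (n - 1)"])
         (auto simp: power_int_def Suc_nat_eq_nat_zadd1 simp flip: power_Suc)
    finally show ?thesis
      unfolding minus_part_def lcoeff_fourier_series[OF assms]
      by (metis has_sum_imp_sums sums_unique)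
  qed
  thus ?thesis using g by (simp add: fourier_series_def)
qed

lemma wiener_parts:
  assumes "wiener S f"
  shows "wiener {..0} (plus_part f)" "wiener {1..} (minus_part f)"
    and "cmod z = 1 \<Longrightarrow> plus_part f z + minus_part f z = f z"
proof -
  obtain c where c: "fourier_series c f" using assms by (auto simp: wiener_def)
  note p = plus_part_series[OF c] and m = minus_part_series[OF c]
  show "wiener {..0} (plus_part f)" "wiener {1..} (minus_part f)"
    using p m unfolding wiener_def by force+
  assume z: "cmod z = 1"
  have "((\<lambda>n. (if n \<in> {..0} then c n else 0) * z powi n + (if n \<in> {1..} then c n else 0) * z powi n)
      has_sum plus_part f z + minus_part f z) UNIV"
    using p m z by (intro has_sum_add) (auto simp: fourier_series_def)
  also have "?this \<longleftrightarrow> ((\<lambda>n. c n * z powi n) has_sum plus_part f z + minus_part f z) UNIV"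
    by (rule has_sum_cong) auto
  finally show "plus_part f z + minus_part f z = f z"
    using c z by (metis fourier_series_def has_sum_unique)
qed

section \<open>Polynomials, their inverses and rational functions on the circle\<close>

lemma wiener_polynomial:
  assumes "wiener {0..int N} f"
  obtains p :: "complex poly" where "degree p \<le> N" "\<And>z. cmod z = 1 \<Longrightarrow> f z = poly p z"
proof -
  obtain c where c: "fourier_series c f" "\<And>n. n \<notin> {0..int N} \<Longrightarrow> c n = 0"
    using assms by (auto simp: wiener_def)
  let ?p = "\<Sum>k\<le>N. monom (c (int k)) k"
  have "f z = poly ?p z" if z: "cmod z = 1" for z
  proof -
    have "((\<lambda>n. c n * z powi n) has_sum f z) UNIV"
      using c z by (auto simp: fourier_series_def)
    moreover have "((\<lambda>n. c n * z powi n) has_sum (\<Sum>n\<in>{0..int N}. c n * z powi n)) UNIV"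
      by (rule has_sum_finite_neutralI[of "{0..int N}"]) (use c(2) in auto)
    moreover have "(\<Sum>n\<in>{0..int N}. c n * z powi n) = poly ?p z"
      by (simp add: poly_sum poly_monom)
         (rule sum.reindex_bij_witness[of _ int nat], auto simp: power_int_def)
    ultimately show ?thesis by (metis has_sum_unique)
  qed
  moreover have "degree ?p \<le> N"
    by (intro degree_sum_le) (auto intro: order_trans[OF degree_monom_le])
  ultimately show ?thesis using that by blast
qed

lemma wiener_poly: "wiener {0..int (degree p)} (poly p)"
  unfolding poly_altdef[abs_def]
  by (intro wiener_sum wiener_cmult)
     (use wiener_powi[of "int _"] in auto)

lemma wiener_power_series:
  assumes "summable (\<lambda>n. norm (a n))" "\<And>z. cmod z = 1 \<Longrightarrow> (\<lambda>n. a n * z ^ n) sums f z"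
  shows "wiener {0..} f"
proof -
  let ?c = "\<lambda>n. if n \<in> {0..} then a (nat n) else 0"
  have "(\<lambda>n. norm (a n)) summable_on UNIV"
    using assms(1) by (simp add: summable_on_UNIV_nonneg_real_iff)
  also have "?this \<longleftrightarrow> (\<lambda>n. norm (a (nat n))) summable_on {0..}"
    by (rule summable_on_reindex_bij_witness[of _ nat int]) auto
  also have "\<dots> \<longleftrightarrow> (\<lambda>n. norm (?c n)) summable_on UNIV"
    by (rule summable_on_cong_neutral) auto
  finally have 1: "(\<lambda>n. norm (?c n)) summable_on UNIV" .
  have 2: "((\<lambda>n. ?c n * z powi n) has_sum f z) UNIV" if z: "cmod z = 1" for z
  proof -
    have "((\<lambda>n. a n * z ^ n) has_sum f z) UNIV"
      using assms z by (intro norm_summable_imp_has_sum) (auto simp: norm_mult norm_power)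
    also have "?this \<longleftrightarrow> ((\<lambda>n. a (nat n) * z powi n) has_sum f z) {0..}"
      by (rule has_sum_reindex_bij_witness[of _ nat int]) (auto simp: power_int_def)
    also have "\<dots> \<longleftrightarrow> ((\<lambda>n. ?c n * z powi n) has_sum f z) UNIV"
      by (rule has_sum_cong_neutral) auto
    finally show ?thesis .
  qed
  show ?thesis unfolding wiener_def fourier_series_def
    by (rule exI[of _ ?c]) (use 1 2 in auto)
qed

lemma wiener_inverse_linear:
  assumes "cmod x > 1"
  shows "wiener {0..} (\<lambda>z. inverse (z - x))"
proof (rule wiener_power_series[where a = "\<lambda>n. - inverse x * inverse x ^ n"])
  have *: "cmod (inverse x) < 1" using assms by (simp add: norm_inverse inverse_less_1_iff)
  show "summable (\<lambda>n. cmod (- inverse x * inverse x ^ n))"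
    using * by (simp add: norm_mult norm_power summable_mult summable_geometric)
  fix z :: complex assume z: "cmod z = 1"
  have "cmod (inverse x * z) < 1" using * z by (simp add: norm_mult)
  hence "(\<lambda>n. (inverse x * z) ^ n) sums (1 / (1 - inverse x * z))" by (rule geometric_sums)
  hence "(\<lambda>n. - inverse x * (inverse x * z) ^ n) sums (- inverse x * (1 / (1 - inverse x * z)))"
    by (rule sums_mult)
  moreover have "x \<noteq> 0" using assms by auto
  hence "1 - inverse x * z = - inverse x * (z - x)" by (simp add: field_simps)
  hence "- inverse x * (1 / (1 - inverse x * z)) = inverse (z - x)"
    using \<open>x \<noteq> 0\<close> by (simp add: divide_inverse)
  ultimately show "(\<lambda>n. - inverse x * inverse x ^ n * z ^ n) sums inverse (z - x)"
    by (simp add: power_mult_distrib mult.assoc)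
qed

text \<open>A geometric series in \<open>x/z\<close>, obtained by conjugating the one in
  \<open>cnj x * z\<close>. The extra factor \<open>z powi (-1)\<close> matters: every inner root
  lowers the exponents by one.\<close>

lemma wiener_inverse_linear_neg:
  assumes "cmod x < 1"
  shows "wiener {..-1} (\<lambda>z. inverse (z - x))"
proof -
  have "wiener {0..} (\<lambda>z. inverse (1 - cnj x * z))"
  proof (rule wiener_power_series[where a = "\<lambda>n. cnj x ^ n"])
    show "summable (\<lambda>n. cmod (cnj x ^ n))"
      using assms by (simp add: norm_power summable_geometric)
    fix z :: complex assume "cmod z = 1"
    hence "cmod (cnj x * z) < 1" using assms by (simp add: norm_mult)
    thus "(\<lambda>n. cnj x ^ n * z ^ n) sums inverse (1 - cnj x * z)"
      using geometric_sums[of "cnj x * z"] by (simp add: power_mult_distrib divide_inverse)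
  qed
  hence "wiener {..0} (\<lambda>z. cnj (inverse (1 - cnj x * z)))"
    by (rule wiener_cnj) auto
  hence "wiener {..-1} (\<lambda>z. z powi (-1) * cnj (inverse (1 - cnj x * z)))"
    by (rule wiener_mult[OF wiener_powi[of "-1" "{-1}", OF singletonI]]) auto
  thus ?thesis
  proof (rule wiener_cong)
    fix z :: complex assume z: "cmod z = 1"
    hence "z \<noteq> 0" "cnj z = inverse z"
      by (auto simp: divide_conv_cnj inverse_eq_divide)
    moreover have "z \<noteq> x" using z assms by auto
    ultimately show "z powi (-1) * cnj (inverse (1 - cnj x * z)) = inverse (z - x)"
      by (simp add: field_simps power_int_minus)
  qed
qed

lemma wiener_inverse_prod:
  assumes "\<And>x. x \<in># M \<Longrightarrow> wiener S (\<lambda>z. inverse (z - x))" "0 \<in> S" "\<And>s t. s \<in> S \<Longrightarrow> t \<in> S \<Longrightarrow> s + t \<in> S"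
  shows "wiener S (\<lambda>z. inverse (poly (\<Prod>x\<in>#M. [:-x, 1:]) z))"
  using assms(1)
proof (induction M)
  case empty
  show ?case using assms(2) by (simp add: wiener_const)
next
  case (add x M)
  have "wiener S (\<lambda>z. inverse (z - x) * inverse (poly (\<Prod>x\<in>#M. [:-x, 1:]) z))"
    by (rule wiener_mult[where S = S and T = S]) (use add assms(3) in auto)
  moreover have "poly [:-x, 1:] z = z - x" for z by simp
  ultimately show ?case
    by (simp only: image_mset_add_mset prod_mset.add_mset poly_mult inverse_mult_distrib)
qed

lemma wiener_inverse_poly:
  assumes "p \<noteq> 0" "\<And>x. poly p x = 0 \<Longrightarrow> wiener S (\<lambda>z. inverse (z - x))"
    "0 \<in> S" "\<And>s t. s \<in> S \<Longrightarrow> t \<in> S \<Longrightarrow> s + t \<in> S"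
  shows "wiener S (\<lambda>z. inverse (poly p z))"
proof -
  have "wiener S (\<lambda>z. inverse (lead_coeff p) * inverse (poly (\<Prod>x\<in>#proots p. [:-x, 1:]) z))"
    by (intro wiener_cmult wiener_inverse_prod) (use assms in auto)
  moreover have "inverse (poly p z) = inverse (lead_coeff p) * inverse (poly (\<Prod>x\<in>#proots p. [:-x, 1:]) z)" for z
    using arg_cong[OF complex_poly_decompose_multiset[of p], of "\<lambda>p. inverse (poly p z)"] by simp
  ultimately show ?thesis by simp
qed

lemma wiener_inverse_poly_outer:
  assumes "\<And>x. cmod x \<le> 1 \<Longrightarrow> poly p x \<noteq> 0"
  shows "wiener {0..} (\<lambda>z. inverse (poly p z))"
proof (rule wiener_inverse_poly)
  show "p \<noteq> 0" using assms[of 0] by auto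
  show "wiener {0..} (\<lambda>z. inverse (z - x))" if "poly p x = 0" for x
    using assms[of x] that by (intro wiener_inverse_linear) force
qed auto

text \<open>The shifts by one from the single roots add up to the degree. Hence dividing by such a
  polynomial a numerator of no larger degree gives a causal function.\<close>

lemma wiener_inverse_monic_inner:
  assumes "lead_coeff p = 1" "\<And>x. poly p x = 0 \<Longrightarrow> cmod x < 1"
  shows "wiener {..- int (degree p)} (\<lambda>z. inverse (poly p z))"
proof -
  have "wiener {..- int (size M)} (\<lambda>z. inverse (poly (\<Prod>x\<in>#M. [:-x, 1:]) z))"
    if "\<And>x. x \<in># M \<Longrightarrow> cmod x < 1" for M
    using that
  proof (induction M)
    case (add x M)
    have "wiener {..- int (size (add_mset x M))}
        (\<lambda>z. inverse (z - x) * inverse (poly (\<Prod>x\<in>#M. [:-x, 1:]) z))"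
      by (rule wiener_mult[OF wiener_inverse_linear_neg add.IH]) (use add.prems in auto)
    moreover have "poly [:-x, 1:] z = z - x" for z by simp
  ultimately show ?case
    by (simp only: image_mset_add_mset prod_mset.add_mset poly_mult inverse_mult_distrib)
  qed (simp add: wiener_const)
  moreover have "cmod x < 1" if "x \<in># proots p" for x
    using that assms by (cases "p = 0") auto
  ultimately have "wiener {..- int (size (proots p))} (\<lambda>z. inverse (poly (\<Prod>x\<in>#proots p. [:-x, 1:]) z))"
    by blast
  thus ?thesis
    using complex_poly_decompose_multiset[of p] assms(1) by (simp add: size_proots_complex)
qed

text \<open>The denominator splits into linear factors whose roots lie strictly inside or strictly
  outside the circle, and both kinds expand geometrically.\<close>

lemma wiener_ratfun:
  assumes "ratfun f"
  shows "wiener UNIV f"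
proof -
  obtain a b where ab: "\<And>z. cmod z = 1 \<Longrightarrow> poly b z \<noteq> 0 \<and> f z = poly a z / poly b z"
    using assms unfolding ratfun_def by blast
  have "wiener UNIV (\<lambda>z. poly a z * inverse (poly b z))"
  proof (rule wiener_mult[OF wiener_poly wiener_inverse_poly[of _ UNIV]])
    show "b \<noteq> 0" using ab[of 1] by auto
    fix x assume "poly b x = 0"
    hence "cmod x > 1 \<or> cmod x < 1" using ab[of x] by force
    thus "wiener UNIV (\<lambda>z. inverse (z - x))"
      using wiener_inverse_linear wiener_inverse_linear_neg wiener_mono by blast
  qed auto
  thus ?thesis by (rule wiener_cong) (use ab in \<open>auto simp: divide_inverse\<close>)
qed

section \<open>Vector- and matrix-valued series\<close>

definition mwiener :: "int set \<Rightarrow> (complex \<Rightarrow> complex^'n^'m) \<Rightarrow> bool" where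
  "mwiener S M \<longleftrightarrow> (\<forall>i j. wiener S (\<lambda>z. M z $ i $ j))"

definition vwiener :: "int set \<Rightarrow> (complex \<Rightarrow> complex^'n) \<Rightarrow> bool" where
  "vwiener S x \<longleftrightarrow> (\<forall>j. wiener S (\<lambda>z. x z $ j))"

lemma mwiener_mult:
  assumes "mwiener S M" "mwiener T N" "\<And>s t. s \<in> S \<Longrightarrow> t \<in> T \<Longrightarrow> s + t \<in> R"
  shows "mwiener R (\<lambda>z. M z ** N z)"
  unfolding mwiener_def matrix_matrix_mult_def vec_lambda_beta
  by (intro allI wiener_sum wiener_mult[OF _ _ assms(3)]) (use assms in \<open>auto simp: mwiener_def\<close>)

lemma vwiener_mult:
  assumes "vwiener S x" "mwiener T N" "\<And>s t. s \<in> S \<Longrightarrow> t \<in> T \<Longrightarrow> s + t \<in> R"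
  shows "vwiener R (\<lambda>z. x z v* N z)"
proof -
  have "wiener R (\<lambda>z. \<Sum>i\<in>UNIV. x z $ i * N z $ i $ j)" for j
    by (intro wiener_sum wiener_mult[OF _ _ assms(3)]) (use assms in \<open>auto simp: mwiener_def vwiener_def\<close>)
  thus ?thesis by (simp add: vwiener_def vector_matrix_mult_def)
qed

lemma vwiener_smult:
  assumes "wiener S f" "vwiener T x" "\<And>s t. s \<in> S \<Longrightarrow> t \<in> T \<Longrightarrow> s + t \<in> R"
  shows "vwiener R (\<lambda>z. f z *s x z)"
  unfolding vwiener_def vector_smult_component
  by (intro allI wiener_mult[OF _ _ assms(3)]) (use assms in \<open>auto simp: vwiener_def\<close>)

lemma mwiener_adj:
  assumes "mwiener S M" "uminus ` S \<subseteq> T"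
  shows "mwiener T (\<lambda>z. adj (M z))"
  unfolding mwiener_def adj_def vec_lambda_beta
  by (intro allI wiener_cnj[OF _ assms(2)]) (use assms in \<open>auto simp: mwiener_def\<close>)

lemma vwiener_cong:
  assumes "vwiener S x" "\<And>z. cmod z = 1 \<Longrightarrow> x z = y z"
  shows "vwiener S y"
  unfolding vwiener_def
proof
  fix j
  show "wiener S (\<lambda>z. y z $ j)"
    by (rule wiener_cong[of S "\<lambda>z. x z $ j"]) (use assms in \<open>auto simp: vwiener_def\<close>)
qed

lemma mwiener_cong:
  assumes "mwiener S M" "\<And>z. cmod z = 1 \<Longrightarrow> M z = N z"
  shows "mwiener S N"
  unfolding mwiener_def
proof (intro allI)
  fix i j
  show "wiener S (\<lambda>z. N z $ i $ j)"
    by (rule wiener_cong[of S "\<lambda>z. M z $ i $ j"]) (use assms in \<open>auto simp: mwiener_def\<close>)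
qed

lemma vwiener_add: "vwiener S x \<Longrightarrow> vwiener S y \<Longrightarrow> vwiener S (\<lambda>z. x z + y z)"
  by (auto simp: vwiener_def intro: wiener_add)

lemma vwiener_diff: "vwiener S x \<Longrightarrow> vwiener S y \<Longrightarrow> vwiener S (\<lambda>z. x z - y z)"
  by (auto simp: vwiener_def intro: wiener_diff)

lemma vwiener_const: "0 \<in> S \<Longrightarrow> vwiener S (\<lambda>_. x)"
  by (auto simp: vwiener_def intro: wiener_const)

lemma mwiener_const: "0 \<in> S \<Longrightarrow> mwiener S (\<lambda>_. M)"
  by (auto simp: mwiener_def intro: wiener_const)

lemma mwiener_diff: "mwiener S M \<Longrightarrow> mwiener S N \<Longrightarrow> mwiener S (\<lambda>z. M z - N z)"
  by (auto simp: mwiener_def intro: wiener_diff)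

lemma mwiener_mat:
  assumes "wiener S f"
  shows "mwiener S (\<lambda>z. mat (f z))"
  unfolding mwiener_def
proof (intro allI)
  fix i j show "wiener S (\<lambda>z. mat (f z) $ i $ j)"
    using assms by (cases "i = j") (simp_all add: mat_def wiener_0)
qed

lemma vwiener_parts:
  assumes "vwiener UNIV x"
  shows "vwiener {..0} (vplus_part x)" "vwiener {1..} (vminus_part x)"
    and "cmod z = 1 \<Longrightarrow> vplus_part x z + vminus_part x z = x z"
  using assms wiener_parts(1)[of UNIV] wiener_parts(2)[of UNIV] wiener_parts(3)[of UNIV]
  by (simp_all add: vwiener_def vplus_part_def vminus_part_def vec_eq_iff)

text \<open>Serves to join an upper and a lower bound on exponents that come from two different
  expressions of the same function.\<close>

lemma wiener_Int:
  assumes "wiener S f" "wiener T f"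
  shows "wiener (S \<inter> T) f"
proof -
  obtain c d where c: "fourier_series c f" "\<And>n. n \<notin> S \<Longrightarrow> c n = 0"
    and d: "fourier_series d f" "\<And>n. n \<notin> T \<Longrightarrow> d n = 0"
    using assms by (auto simp: wiener_def)
  have "c n = d n" for n
    using lcoeff_fourier_series[OF c(1), of n] lcoeff_fourier_series[OF d(1), of n] by simp
  hence "\<forall>n. n \<notin> S \<inter> T \<longrightarrow> c n = 0" using c(2) d(2) by auto
  thus ?thesis using c(1) wiener_def by blast
qed

lemma ratfun_inverse:
  assumes "ratfun f" "\<And>z. cmod z = 1 \<Longrightarrow> f z \<noteq> 0"
  shows "ratfun (\<lambda>z. inverse (f z))"
proof -
  obtain a b where ab: "\<And>z. cmod z = 1 \<Longrightarrow> poly b z \<noteq> 0 \<and> f z = poly a z / poly b z"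
    using assms(1) unfolding ratfun_def by blast
  have "\<forall>z. cmod z = 1 \<longrightarrow> poly a z \<noteq> 0 \<and> inverse (f z) = poly b z / poly a z"
    using ab assms(2) by (metis divide_eq_0_iff inverse_divide)
  thus ?thesis unfolding ratfun_def by blast
qed

lemma wiener_poly_atLeast: "wiener {0..} (poly p)"
  by (rule wiener_mono[OF wiener_poly]) auto

lemma wiener_poly_atMost: "wiener {..int (degree p)} (poly p)"
  by (rule wiener_mono[OF wiener_poly]) auto

section \<open>Spectral factorization of self-reciprocal polynomials\<close>

lemma poly_eq_on_infinite:
  fixes p q :: "'a :: idom poly"
  assumes "infinite S" "\<And>z. z \<in> S \<Longrightarrow> poly p z = poly q z"
  shows "p = q"
proof (rule ccontr)
  assume "p \<noteq> q"
  hence "finite {z. poly (p - q) z = 0}" by (intro poly_roots_finite) simp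
  moreover have "S \<subseteq> {z. poly (p - q) z = 0}" using assms(2) by auto
  ultimately show False using assms(1) finite_subset by blast
qed

lemma infinite_unit_circle: "infinite {z :: complex. cmod z = 1}"
proof
  assume fin: "finite {z :: complex. cmod z = 1}"
  have "inj_on (\<lambda>x. cis x) {0..1}"
  proof (rule inj_onI)
    fix x y :: real assume *: "x \<in> {0..1}" "y \<in> {0..1}" "cis x = cis y"
    hence "cos x = cos y" by (simp add: complex_eq_iff)
    thus "x = y" using * pi_gt3 cos_inj_pi[of x y] by auto
  qed
  moreover have "cis ` {0..1} \<subseteq> {z. cmod z = 1}" by auto
  ultimately have "finite {0..1::real}" using fin finite_subset finite_image_iff by blast
  thus False using infinite_Icc[of 0 "1::real"] by simp
qed

lemma poly_prod_mset_linear: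
  "poly (\<Prod>x\<in>#A. [:-x, 1:]) z = (\<Prod>x\<in>#A. z - x :: 'a :: comm_ring_1)"
  by (induction A) (auto simp: algebra_simps)

lemma poly_prod_mset_linear_reflect:
  "poly (\<Prod>x\<in>#A. [:1, -x:]) z = (\<Prod>x\<in>#A. 1 - x * z :: 'a :: comm_ring_1)"
  by (induction A) (auto simp: algebra_simps)

lemma prod_mset_reflect:
  "z \<noteq> 0 \<Longrightarrow> (\<Prod>x\<in>#A. 1 - x * z) = z ^ size A * (\<Prod>x\<in>#A. inverse z - x :: 'a :: field)"
  by (induction A) (auto simp: field_simps)

lemma proots_prod_mset_linear:
  "proots (\<Prod>x\<in>#A. [:-x, 1:]) = (A :: 'a :: idom multiset)"
proof (induction A)
  case (add x A)
  have "(\<Prod>x\<in>#A. [:-x, 1:]) \<noteq> 0" by (auto simp: prod_mset_zero_iff)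
  thus ?case using add by (simp add: proots_mult del: mult_pCons_left)
qed auto

lemma lead_coeff_prod_mset_linear: "lead_coeff (\<Prod>x\<in>#A. [:-x, 1:]) = (1 :: 'a :: idom)"
  by (induction A) (auto simp: lead_coeff_mult simp del: mult_pCons_left)

lemma degree_prod_mset_linear: "degree (\<Prod>x\<in>#A. [:-x, 1 :: 'a :: idom:]) = size A"
proof (induction A)
  case (add x A)
  have "(\<Prod>x\<in>#A. [:-x, 1:]) \<noteq> 0" by (auto simp: prod_mset_zero_iff)
  thus ?case using add by (simp add: degree_mult_eq del: mult_pCons_left)
qed auto

lemma degree_prod_mset_linear_reflect:
  assumes "0 \<notin># A"
  shows "degree (\<Prod>x\<in>#A. [:1 :: 'a :: idom, -x:]) = size A"
  using assms
proof (induction A)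
  case (add x A)
  have "(\<Prod>x\<in>#A. [:1, -x:]) \<noteq> 0" by (auto simp: prod_mset_zero_iff)
  thus ?case using add by (simp add: degree_mult_eq del: mult_pCons_left)
qed auto

text \<open>Conjugating the linear factorization of \<open>f\<close> yields a second factorization
  of \<open>f\<close>, and \<open>proots\<close> reads off the same multiset from both,
  multiplicities included.\<close>

lemma proots_cnj:
  assumes "\<And>z. poly f (cnj z) = cnj (poly f z)"
  shows "image_mset cnj (proots f) = proots f"
proof (cases "f = 0")
  case False
  define A where "A = proots f"
  define l where "l = lead_coeff f"
  have f: "poly f z = l * (\<Prod>x\<in>#A. z - x)" for z
    using arg_cong[OF complex_poly_decompose_multiset[of f], of "\<lambda>p. poly p z"]
    by (simp add: poly_prod_mset_linear A_def l_def)
  have c: "cnj (\<Prod>x\<in>#A. cnj z - x) = (\<Prod>x\<in>#image_mset cnj A. z - x)" for z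
    by (induction A) auto
  have "f = smult (cnj l) (\<Prod>x\<in>#image_mset cnj A. [:-x, 1:])"
  proof (rule poly_eq_on_infinite[of UNIV])
    show "poly f z = poly (smult (cnj l) (\<Prod>x\<in>#image_mset cnj A. [:-x, 1:])) z" for z
    proof -
      have "poly f z = cnj (poly f (cnj z))" using assms[of "cnj z"] by simp
      also have "\<dots> = cnj l * (\<Prod>x\<in>#image_mset cnj A. z - x)"
        by (simp only: f complex_cnj_mult c)
      finally show ?thesis by (simp only: poly_smult poly_prod_mset_linear)
    qed
  qed (simp add: infinite_UNIV_char_0)
  moreover have "cnj l \<noteq> 0" using False by (simp add: l_def)
  ultimately have "proots f = image_mset cnj A"
    using proots_prod_mset_linear[of "image_mset cnj A"] by (metis proots_smult)
  thus ?thesis by (simp add: A_def)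
qed auto

text \<open>Inverting all roots turns \<open>f\<close> into itself, so \<open>f = G * H\<close> where the roots of \<open>G\<close> are the inverses of
  the inner roots. Comparing inner roots shows that \<open>H\<close> is a multiple of \<open>g\<close>, which also gives the degree.\<close>

lemma self_reciprocal_factorization:
  fixes f :: "complex poly"
  assumes deg: "degree f \<le> 2 * N"
    and recip: "\<And>z. z \<noteq> 0 \<Longrightarrow> poly f z = z ^ (2 * N) * poly f (inverse z)"
    and circle: "\<And>z. cmod z = 1 \<Longrightarrow> poly f z \<noteq> 0"
    and real: "\<And>z. poly f (cnj z) = cnj (poly f z)"
  obtains g h c where "f = g * h" "degree g = N" "lead_coeff g = 1"
    "\<And>z. poly g z = 0 \<Longrightarrow> cmod z < 1" "\<And>z. cmod z \<le> 1 \<Longrightarrow> poly h z \<noteq> 0"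
    "\<And>z. poly g (cnj z) = cnj (poly g z)"
    "\<And>z. z \<noteq> 0 \<Longrightarrow> poly h z = c * z ^ N * poly g (inverse z)"
proof -
  have f0: "f \<noteq> 0" using circle[of 1] by auto
  define l where "l = lead_coeff f"
  have l0: "l \<noteq> 0" using f0 by (simp add: l_def)
  define I where "I = filter_mset (\<lambda>z. cmod z < 1) (proots f)"
  define J where "J = filter_mset (\<lambda>z. \<not> cmod z < 1) (proots f)"
  have IJ: "proots f = I + J" by (simp add: I_def J_def)
  have I1: "cmod x < 1" if "x \<in># I" for x using that by (simp add: I_def)
  have J1: "cmod x > 1" if "x \<in># J" for x
    using that circle[of x] f0 by (force simp: J_def)
  have sz: "degree f = size I + size J" using size_proots_complex[of f] IJ by simp
  define g where "g = (\<Prod>x\<in>#I. [:-x, 1:])"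
  define G where "G = (\<Prod>x\<in>#I. [:1, -x:])"
  \<comment> \<open>If \<open>degree f\<close> falls short of \<open>2 * N\<close>, the missing
    roots sit at infinity; inversion moves them to 0, which the monomial accounts for.\<close>
  define H where "H = smult l (monom 1 (2 * N - degree f) * (\<Prod>x\<in>#J. [:1, -x:]))"
  have f: "poly f z = l * ((\<Prod>x\<in>#I. z - x) * (\<Prod>x\<in>#J. z - x))" for z
    using arg_cong[OF complex_poly_decompose_multiset[of f], of "\<lambda>p. poly p z"]
    by (simp add: poly_prod_mset_linear IJ l_def)
  have fGH: "f = G * H"
  proof (rule poly_eq_on_infinite[of "- {0}"])
    fix z :: complex assume "z \<in> - {0}"
    hence z: "z \<noteq> 0" by simp
    have "poly f z = z ^ (2 * N - degree f) * z ^ size I * z ^ size J * poly f (inverse z)"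
      unfolding recip[OF z] using deg sz by (simp flip: power_add)
    also have "\<dots> = poly (G * H) z"
      using z by (simp add: f G_def H_def poly_monom poly_prod_mset_linear_reflect prod_mset_reflect)
    finally show "poly f z = poly (G * H) z" .
  qed (simp add: infinite_UNIV_char_0)
  have G0: "G \<noteq> 0" and H0: "H \<noteq> 0" using fGH f0 by auto
  have rG: "cmod z > 1" if rt: "poly G z = 0" for z
  proof -
    obtain x where x: "x \<in># I" "x * z = 1"
      using rt by (auto simp: G_def poly_prod_mset_linear_reflect prod_mset_zero_iff)
    hence *: "cmod x * cmod z = 1" by (metis norm_mult norm_one)
    show ?thesis
    proof (rule ccontr)
      assume "\<not> ?thesis"
      hence "cmod x * cmod z \<le> cmod x" by (intro mult_left_le) auto
      thus False using * I1[OF x(1)] by linarith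
    qed
  qed
  have rH: "cmod z < 1" if rt: "poly H z = 0" for z
  proof (cases "z = 0")
    case False
    then obtain x where x: "x \<in># J" "x * z = 1"
      using rt l0 by (auto simp: H_def poly_monom poly_prod_mset_linear_reflect prod_mset_zero_iff)
    hence *: "cmod x * cmod z = 1" by (metis norm_mult norm_one)
    show ?thesis
    proof (rule ccontr)
      assume "\<not> ?thesis"
      hence "cmod x * 1 \<le> cmod x * cmod z" by (intro mult_left_mono) auto
      thus False using * J1[OF x(1)] by linarith
    qed
  qed simp
  have "I = filter_mset (\<lambda>z. cmod z < 1) (proots G) + filter_mset (\<lambda>z. cmod z < 1) (proots H)"
    unfolding I_def by (subst fGH) (simp add: proots_mult G0 H0)
  also have "filter_mset (\<lambda>z. cmod z < 1) (proots G) = {#}"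
    using rG G0 by (fastforce simp: filter_mset_eq_conv)
  also have "filter_mset (\<lambda>z. cmod z < 1) (proots H) = proots H"
    using rH H0 by (auto simp: filter_mset_eq_conv)
  finally have I: "proots H = I" by simp
  define c where "c = lead_coeff H"
  have H: "H = smult c g"
    using complex_poly_decompose_multiset[of H] by (simp add: I c_def g_def)
  \<comment> \<open>Root count: \<open>size I = 2 * N - degree f + size J\<close> together with
    \<open>degree f = size I + size J\<close> forces \<open>size I = N\<close>.\<close>
  have "size I = degree H" using size_proots_complex[of H] I by simp
  also have "0 \<notin># J" using J1 by force
  hence "degree H = 2 * N - degree f + size J"
  proof -
    have "(\<Prod>x\<in>#J. [:1, -x:]) \<noteq> 0" by (auto simp: prod_mset_zero_iff)
    thus ?thesis using l0 \<open>0 \<notin># J\<close>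
      by (simp add: H_def degree_mult_eq degree_monom_eq degree_prod_mset_linear_reflect)
  qed
  finally have N: "size I = N" using deg sz by linarith
  show ?thesis
  proof
    show "f = g * smult c G" using fGH H by (simp add: mult.commute)
    show "degree g = N" "lead_coeff g = 1"
      using degree_prod_mset_linear[of I] lead_coeff_prod_mset_linear[of I] N by (simp_all add: g_def)
    show "cmod z < 1" if "poly g z = 0" for z
      using that I1 by (auto simp: g_def poly_prod_mset_linear prod_mset_zero_iff)
    have "c \<noteq> 0" using H0 by (simp add: c_def)
    thus "poly (smult c G) z \<noteq> 0" if "cmod z \<le> 1" for z
      using rG[of z] that by auto
    have "image_mset cnj I = I"
      using arg_cong[OF proots_cnj[OF real], of "filter_mset (\<lambda>z. cmod z < 1)"]
      by (simp add: filter_mset_image_mset I_def)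
    thus "poly g (cnj z) = cnj (poly g z)" for z
    proof -
      have "poly g (cnj z) = (\<Prod>x\<in>#image_mset cnj I. cnj z - x)"
        using \<open>image_mset cnj I = I\<close> by (simp only: g_def poly_prod_mset_linear)
      also have "\<dots> = cnj (\<Prod>x\<in>#I. z - x)" by (induction I) auto
      finally show ?thesis by (simp only: g_def poly_prod_mset_linear)
    qed
    show "poly (smult c G) z = c * z ^ N * poly g (inverse z)" if "z \<noteq> 0" for z
      using that by (simp add: G_def g_def poly_prod_mset_linear_reflect poly_prod_mset_linear prod_mset_reflect N)
  qed
qed

text \<open>The circle is infinite, so the symmetry there already fixes all coefficients. The
  numerators of the filter are compared with it only on the circle.\<close>

lemma real_poly_of_cnj:
  fixes f :: "complex poly"
  assumes "\<And>z. cmod z = 1 \<Longrightarrow> poly f (cnj z) = cnj (poly f z)"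
  obtains q :: "real poly" where "f = map_poly of_real q" "degree q = degree f"
proof -
  have "map_poly cnj f = f"
  proof (rule poly_eq_on_infinite[OF infinite_unit_circle])
    fix z :: complex assume "z \<in> {z. cmod z = 1}"
    thus "poly (map_poly cnj f) z = poly f z" using assms[of z] by simp
  qed
  hence r: "cnj (coeff f i) = coeff f i" for i
    by (metis coeff_map_poly complex_cnj_zero)
  have re: "of_real (Re (coeff f i)) = coeff f i" for i
    using r[of i] by (simp add: complex_eq_iff)
  have "f = map_poly of_real (map_poly Re f)"
    by (rule poly_eqI) (simp add: coeff_map_poly re)
  moreover have "degree (map_poly of_real (map_poly Re f) :: complex poly) = degree (map_poly Re f)"
    by (rule degree_map_poly) simp
  ultimately show ?thesis using that by metis
qed

lemma lpoly_real: "cmod z = 1 \<Longrightarrow> lpoly p m (cnj z) = cnj (lpoly p m z)"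
  by (simp add: lpoly_def)

text \<open>Fejer-Riesz factorization. Symmetry of the coefficients makes
  \<open>z ^ m * lpoly p m z\<close> self-reciprocal, and positivity excludes roots on the circle.
  \<open>degree g = m\<close> holds even when \<open>p m = 0\<close>; the lost degree then appears
  as roots of \<open>g\<close> at 0.\<close>

lemma laurent_factorization:
  fixes p :: "int \<Rightarrow> real"
  assumes sym: "\<forall>k. p (- k) = p k" and pos: "\<forall>z. cmod z = 1 \<longrightarrow> Re (lpoly p m z) > 0"
  obtains g h :: "complex poly" and c :: real
  where "degree g = m" "lead_coeff g = 1" "\<And>z. poly g z = 0 \<Longrightarrow> cmod z < 1"
    "\<And>z. cmod z \<le> 1 \<Longrightarrow> poly h z \<noteq> 0" "\<And>z. poly g (cnj z) = cnj (poly g z)"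
    "c > 0" "\<And>z. cmod z = 1 \<Longrightarrow> lpoly p m z = of_real c * (cnj (poly g z) * poly g z)"
    "\<And>z. cmod z = 1 \<Longrightarrow> z ^ m * lpoly p m z = poly g z * poly h z"
proof -
  define f :: "complex poly" where
    "f = (\<Sum>k\<in>{- int m..int m}. monom (of_real (p k)) (nat (int m - k)))"
  have f: "poly f z = z ^ m * lpoly p m z" if "z \<noteq> 0" for z
    unfolding f_def poly_sum poly_monom lpoly_def sum_distrib_left
  proof (rule sum.cong)
    fix k assume "k \<in> {- int m..int m}"
    hence "z ^ nat (int m - k) = z powi (int m + - k)" by (simp add: power_int_def)
    also have "\<dots> = z ^ m * z powi (- k)" using that by (subst power_int_add) auto
    finally show "of_real (p k) * z ^ nat (int m - k) = z ^ m * (of_real (p k) * z powi (- k))"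
      by simp
  qed simp
  have lrec: "lpoly p m (inverse z) = lpoly p m z" for z
    unfolding lpoly_def
    by (rule sum.reindex_bij_witness[of _ uminus uminus])
       (use sym in \<open>auto simp: power_int_inverse power_int_minus\<close>)
  have nz: "lpoly p m z \<noteq> 0" if "cmod z = 1" for z
    using pos that by force
  have 1: "degree f \<le> 2 * m"
    unfolding f_def by (rule degree_sum_le) (auto intro!: order_trans[OF degree_monom_le])
  have 2: "poly f z = z ^ (2 * m) * poly f (inverse z)" if "z \<noteq> 0" for z
    using that by (simp add: f lrec) (simp add: mult_2 mult_2_right power_add field_simps)
  have 3: "poly f z \<noteq> 0" if "cmod z = 1" for z
    using nz[OF that] that by (subst f) auto
  have 4: "poly f (cnj z) = cnj (poly f z)" for z
    by (simp add: f_def poly_sum poly_monom)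
  obtain g h c where g: "f = g * h" "degree g = m" "lead_coeff g = 1"
    "\<And>z. poly g z = 0 \<Longrightarrow> cmod z < 1" "\<And>z. cmod z \<le> 1 \<Longrightarrow> poly h z \<noteq> 0"
    "\<And>z. poly g (cnj z) = cnj (poly g z)"
    "\<And>z. z \<noteq> 0 \<Longrightarrow> poly h z = c * z ^ m * poly g (inverse z)"
    using self_reciprocal_factorization[OF 1 2 3 4] by metis
  have L: "lpoly p m z = c * (cnj (poly g z) * poly g z)" if "cmod z = 1" for z
  proof -
    note z = unit_circle_inverse[OF that]
    have "z ^ m * lpoly p m z = poly g z * (c * z ^ m * cnj (poly g z))"
      by (simp only: f[OF z(1), symmetric] g(1) poly_mult g(7)[OF z(1)] z(2) g(6))
    also have "\<dots> = z ^ m * (c * (cnj (poly g z) * poly g z))" by (simp only: mult_ac)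
    finally show ?thesis using z(1) by simp
  qed
  \<comment> \<open>Evaluation at 1 determines the constant: there both the Laurent polynomial and
    the squared modulus of \<open>g\<close> are positive reals.\<close>
  have g1: "poly g 1 \<noteq> 0" using g(4)[of 1] by auto
  have "c * of_real ((cmod (poly g 1))\<^sup>2) = of_real (\<Sum>k\<in>{- int m..int m}. p k)"
    using L[of 1] by (simp add: lpoly_def complex_norm_square mult.commute del: of_real_power)
  hence "c = of_real ((\<Sum>k\<in>{- int m..int m}. p k) / (cmod (poly g 1))\<^sup>2)"
    using g1 by (simp add: field_simps)
  then obtain c' where c': "c = of_real c'" by blast
  have "Re (c * of_real ((cmod (poly g 1))\<^sup>2)) > 0"
    using pos[rule_format, of 1] L[of 1] by (simp add: complex_norm_square mult.commute del: of_real_power)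
  hence "c' > 0" by (simp add: c' zero_less_mult_iff g1)
  show ?thesis
  proof (rule that[of g h c'])
    show "z ^ m * lpoly p m z = poly g z * poly h z" if "cmod z = 1" for z
      using f[of z] g(1) that by (metis norm_zero poly_mult zero_neq_one)
  qed (use g L c' \<open>c' > 0\<close> in auto)
qed

text \<open>The quotient of the two monic inner factors, scaled by a constant. Equal degrees make it
  causal together with its inverse.\<close>

lemma canonical_U_exists:
  assumes p: "\<forall>k. p (- k) = p k" "\<forall>z. cmod z = 1 \<longrightarrow> Re (lpoly p m z) > 0"
    and q: "\<forall>k. q (- k) = q k" "\<forall>z. cmod z = 1 \<longrightarrow> Re (lpoly q m z) > 0"
  shows "\<exists>U. ratfun U \<and> canonical_U p q m U"
proof -
  obtain a c where a: "degree a = m" "lead_coeff a = 1" "\<And>z. poly a z = 0 \<Longrightarrow> cmod z < 1"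
    "c > 0" "\<And>z. cmod z = 1 \<Longrightarrow> lpoly p m z = of_real c * (cnj (poly a z) * poly a z)"
    using laurent_factorization[OF p] by metis
  obtain b d where b: "degree b = m" "lead_coeff b = 1" "\<And>z. poly b z = 0 \<Longrightarrow> cmod z < 1"
    "d > 0" "\<And>z. cmod z = 1 \<Longrightarrow> lpoly q m z = of_real d * (cnj (poly b z) * poly b z)"
    using laurent_factorization[OF q] by metis
  define r where "r = sqrt (c / d)"
  have r: "r \<noteq> 0" "r * r = c / d" using a(4) b(4) by (auto simp: r_def)
  \<comment> \<open>The numerator has exponents at most \<open>m\<close>, the inverse of the
    denominator at most \<open>- m\<close>.\<close>
  have quot: "causal (\<lambda>z. of_real s * (poly u z * inverse (poly v z)))"
    if "degree u = m" "degree v = m" "lead_coeff v = 1" "\<And>z. poly v z = 0 \<Longrightarrow> cmod z < 1" for s :: real and u v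
    by (intro causal_wiener wiener_cmult wiener_mult[OF wiener_poly_atMost wiener_inverse_monic_inner[OF that(3,4)]])
       (use that in auto)
  define U where "U z = of_real r * (poly a z * inverse (poly b z))" for z
  have inv: "inverse (U z) = of_real (inverse r) * (poly b z * inverse (poly a z))" for z
    by (simp add: U_def)
  have "ratfun U"
    unfolding ratfun_def U_def
    by (rule exI[of _ "smult (of_real r) a"], rule exI[of _ b]) (use b(3) in \<open>force simp: divide_inverse\<close>)
  moreover have "causal U" "causal (\<lambda>z. inverse (U z))"
    unfolding inv unfolding U_def[abs_def] by (intro quot; use a b in auto)+
  moreover have "cnj (U z) * U z = lpoly p m z / lpoly q m z" if "cmod z = 1" for z
  proof -
    have "poly b z \<noteq> 0" using b(3)[of z] that by auto
    moreover have "complex_of_real r * complex_of_real r = of_real c / of_real d"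
      using r(2) by (metis of_real_divide of_real_mult)
    ultimately show ?thesis
      using b(4) by (simp add: U_def a(5)[OF that] b(5)[OF that] field_simps)
  qed
  ultimately show ?thesis unfolding canonical_U_def by blast
qed

section \<open>Companion realization of a row of rational functions\<close>

lemma invertible_matrix_inv:
  fixes M :: "'a::semiring_1^'n^'m"
  assumes "invertible M"
  shows "M ** matrix_inv M = mat 1" "matrix_inv M ** M = mat 1"
  using someI_ex[OF assms[unfolded invertible_def]] by (simp_all add: matrix_inv_def)

lemma invertible_iff_kernel:
  fixes M :: "'a::field^'n^'n"
  shows "invertible M \<longleftrightarrow> (\<forall>x. M *v x = 0 \<longrightarrow> x = 0)"
  unfolding invertible_left_inverse matrix_left_invertible_ker ..

lemma mat_minus_mult_vec: "((mat z - M) *v x) $ i = z * x $ i - (\<Sum>k\<in>UNIV. M $ i $ k * x $ k)"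
  for M :: "complex^'n^'n"
proof -
  have "(mat z *v x) $ i = z * x $ i"
    by (simp add: mat_def matrix_vector_mult_def if_distrib if_distribR cong: if_cong)
  thus ?thesis
    by (simp add: matrix_vector_mult_diff_rdistrib) (simp add: matrix_vector_mult_def)
qed

lemma vec_mult_mat_minus: "(x v* (mat z - M)) $ k = z * x $ k - (\<Sum>i\<in>UNIV. x $ i * M $ i $ k)"
  for M :: "complex^'n^'n"
proof -
  have "(x v* (mat z - M)) $ k = (\<Sum>i\<in>UNIV. x $ i * (if i = k then z else 0) - x $ i * M $ i $ k)"
    by (simp only: vector_matrix_mult_def vec_lambda_beta mat_def vector_minus_component right_diff_distrib mult.commute)
  also have "\<dots> = z * x $ k - (\<Sum>i\<in>UNIV. x $ i * M $ i $ k)"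
    by (simp only: sum_subtractf) (simp add: if_distrib cong: if_cong)
  finally show ?thesis .
qed

text \<open>All entries share one denominator, so one set of states serves them all. The row
  \<open>H (zI - F)^{-1}\<close> consists of the powers of \<open>z\<close> divided by
  \<open>d\<close>; a column of \<open>G\<close> therefore just lists the coefficients of a
  numerator from which its direct feedthrough times \<open>d\<close> was subtracted.\<close>

lemma companion_realization:
  fixes d :: "real poly" and N :: "'y::finite \<Rightarrow> real poly"
  assumes card: "CARD('r) = degree d" and monic: "lead_coeff d = 1"
    and roots: "\<And>z. poly (map_poly of_real d) z = 0 \<Longrightarrow> cmod z < 1"
    and deg: "\<And>j. degree (N j) \<le> degree d"
  obtains F :: "real^'r^'r" and G :: "real^'y^'r" and H :: "real^'r" and L :: "real^'y"
  where "schur_stable F"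
    "\<And>z j. cmod z = 1 \<Longrightarrow>
       ss_tf F G H L z $ j = poly (map_poly of_real (N j)) z / poly (map_poly of_real d) z"
proof -
  let ?r = "degree d"
  have r: "?r > 0" using card by (metis zero_less_card_finite)
  obtain b :: "'r \<Rightarrow> nat" where b: "bij_betw b UNIV {0..<?r}"
    using ex_bij_betw_finite_nat[of "UNIV :: 'r set"] card by auto
  have inj: "b i = b k \<longleftrightarrow> i = k" for i k using b by (auto simp: bij_betw_def inj_on_def)
  have bl: "b i < ?r" for i using b by (auto simp: bij_betw_def)
  have ex: "\<exists>i. b i = k" if "k < ?r" for k using b that by (auto simp: bij_betw_def) (metis atLeastLessThan_iff image_iff le0)
  \<comment> \<open>The states are ordered by \<open>b\<close>. The last column holds the negated
    coefficients of \<open>d\<close> and ones stand below the diagonal, which makes the row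
    \<open>x z\<close> of powers satisfy \<open>x z (zI - F) = d(z) H\<close>.\<close>
  define F :: "real^'r^'r" where
    "F = (\<chi> i k. if Suc (b k) = ?r then - coeff d (b i) else if b i = Suc (b k) then 1 else 0)"
  define H :: "real^'r" where "H = (\<chi> k. if Suc (b k) = ?r then 1 else 0)"
  define L :: "real^'y" where "L = (\<chi> j. coeff (N j) ?r)"
  define G :: "real^'y^'r" where "G = (\<chi> i j. coeff (N j - smult (coeff (N j) ?r) d) (b i))"
  let ?d = "\<lambda>z::complex. poly (map_poly of_real d) z"
  define x :: "complex \<Rightarrow> complex^'r" where "x z = (\<chi> i. z ^ b i)" for z
  have sumb: "(\<Sum>i\<in>UNIV. g (b i)) = (\<Sum>k<?r. g k)" for g :: "nat \<Rightarrow> complex"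
    using sum.reindex_bij_betw[OF b, of g] by (simp add: lessThan_atLeast0)
  have polyr: "poly (map_poly of_real p) z = (\<Sum>k\<le>n. of_real (coeff p k) * z ^ k)"
    if "degree p \<le> n" for p :: "real poly" and z :: complex and n
    using that unfolding poly_altdef
    by (intro sum.mono_neutral_cong_left) (auto simp: coeff_map_poly degree_map_poly coeff_eq_0)
  have xF: "(x z v* (mat z - cmat F)) $ k = ?d z * of_real (H $ k)" for z k
  proof -
    have "(x z v* (mat z - cmat F)) $ k = z * z ^ b k - (\<Sum>i\<in>UNIV. z ^ b i * of_real (F $ i $ k))"
      by (simp add: vec_mult_mat_minus x_def cmat_def)
    also have "\<dots> = ?d z * of_real (H $ k)"
    proof (cases "Suc (b k) = ?r")
      case True
      have "(\<Sum>i\<in>UNIV. z ^ b i * of_real (F $ i $ k)) = - (\<Sum>i<?r. of_real (coeff d i) * z ^ i)"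
        using True sumb[of "\<lambda>i. of_real (coeff d i) * z ^ i"] by (simp add: F_def sum_negf mult.commute)
      moreover have "?d z = (\<Sum>i<?r. of_real (coeff d i) * z ^ i) + z ^ ?r"
        using monic by (simp add: polyr[OF order_refl] flip: lessThan_Suc_atMost)
      ultimately show ?thesis using True by (simp add: H_def flip: power_Suc)
    next
      case False
      then obtain i where i: "b i = Suc (b k)" using ex[of "Suc (b k)"] bl[of k] by auto
      have "(\<Sum>i\<in>UNIV. z ^ b i * of_real (F $ i $ k)) = (\<Sum>i'\<in>UNIV. if i' = i then z ^ b i' else 0)"
        using False i inj[of _ i] by (intro sum.cong) (auto simp: F_def)
      thus ?thesis using False i by (simp add: H_def)
    qed
    finally show ?thesis .
  qed
  have inv: "invertible (mat z - cmat F)" if z: "?d z \<noteq> 0" for z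
    unfolding invertible_iff_kernel
  proof (intro allI impI)
    fix w assume w: "(mat z - cmat F) *v w = 0"
    obtain l where l: "Suc (b l) = ?r" using ex[of "?r - 1"] r by (metis Suc_diff_1 diff_less zero_less_one)
    have Sl: "Suc (b k) = ?r \<longleftrightarrow> k = l" for k
      unfolding l[symmetric] by (simp add: inj)
    have "?d z * w $ l = (\<Sum>k\<in>UNIV. (x z v* (mat z - cmat F)) $ k * w $ k)"
      by (simp add: xF H_def Sl if_distrib if_distribR cong: if_cong)
    also have "\<dots> = (\<Sum>k\<in>UNIV. \<Sum>i\<in>UNIV. x z $ i * (mat z - cmat F) $ i $ k * w $ k)"
      by (simp add: vector_matrix_mult_def sum_distrib_right)
    also have "\<dots> = (\<Sum>i\<in>UNIV. x z $ i * ((mat z - cmat F) *v w) $ i)"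
      by (subst sum.swap) (simp add: matrix_vector_mult_def sum_distrib_left mult.assoc)
    also have "\<dots> = 0" using w by simp
    finally have wl: "w $ l = 0" using z by simp
    \<comment> \<open>Descent from the last state: as \<open>w $ l = 0\<close>, the row of the
      successor \<open>i\<close> of \<open>k\<close> reduces to
      \<open>z * w $ i = w $ k\<close>.\<close>
    have "w $ k = 0" if "b k + n = b l" for k n
      using that
    proof (induction n arbitrary: k)
      case 0
      thus ?case using wl inj by simp
    next
      case (Suc n)
      then obtain i where i: "b i = Suc (b k)" using ex[of "Suc (b k)"] bl[of l] by auto
      have ne: "Suc (b k) \<noteq> ?r" using Suc.prems l by simp
      have wi: "w $ i = 0" using Suc.IH[of i] Suc.prems i by simp
      have "0 = ((mat z - cmat F) *v w) $ i" using w by simp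
      also have "\<dots> = z * w $ i - (\<Sum>k\<in>UNIV. cmat F $ i $ k * w $ k)"
        by (rule mat_minus_mult_vec)
      also have "(\<Sum>k\<in>UNIV. cmat F $ i $ k * w $ k) = (\<Sum>k'\<in>UNIV. if k' = k then w $ k' else 0)"
      proof (rule sum.cong)
        fix k'
        show "cmat F $ i $ k' * w $ k' = (if k' = k then w $ k' else 0)"
        proof (cases "Suc (b k') = ?r")
          case True
          thus ?thesis using wl Sl by auto
        next
          case False
          thus ?thesis using i inj by (auto simp: cmat_def F_def)
        qed
      qed simp
      finally show ?case using wi by simp
    qed
    moreover have "\<exists>n. b k + n = b l" for k
      using bl[of k] l by (intro exI[of _ "b l - b k"]) simp
    ultimately have "w $ k = 0" for k by blast
    thus "w = 0" by (simp add: vec_eq_iff)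
  qed
  show ?thesis
  proof
    show "schur_stable F" unfolding schur_stable_def
      using inv roots by (meson not_less)
    fix z :: complex and j assume "cmod z = 1"
    hence d0: "?d z \<noteq> 0" using roots[of z] by auto
    let ?R = "matrix_inv (mat z - cmat F)"
    have x: "x z v* (mat z - cmat F) = ?d z *s cvec H"
      by (simp add: vec_eq_iff xF cvec_def)
    have "x z = (x z v* (mat z - cmat F)) v* ?R"
      using invertible_matrix_inv(1)[OF inv[OF d0]] by (simp add: vector_matrix_mul_assoc)
    also have "\<dots> = ?d z *s (cvec H v* ?R)"
      unfolding x by (simp add: vec_eq_iff vector_matrix_mult_def sum_distrib_left mult.assoc)
    finally have "?d z *s (cvec H v* ?R) = x z" by simp
    hence HR: "(cvec H v* ?R) $ i = z ^ b i / ?d z" for i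
      using d0 by (simp add: vec_eq_iff x_def field_simps)
    have "((cvec H v* ?R) v* cmat G) $ j = (\<Sum>i\<in>UNIV. z ^ b i * of_real (G $ i $ j)) / ?d z"
      unfolding vector_matrix_mult_def[of "cvec H v* ?R"] vec_lambda_beta HR
      by (simp add: cmat_def sum_divide_distrib)
    also have "(\<Sum>i\<in>UNIV. z ^ b i * of_real (G $ i $ j)) =
      (\<Sum>k<?r. of_real (coeff (N j - smult (coeff (N j) ?r) d) k) * z ^ k)"
      using sumb[of "\<lambda>k. of_real (coeff (N j - smult (coeff (N j) ?r) d) k) * z ^ k"]
      by (simp add: G_def mult.commute)
    \<comment> \<open>The added top coefficient is zero, because \<open>d\<close> is monic.\<close>
    also have "\<dots> = (\<Sum>k\<le>?r. of_real (coeff (N j - smult (coeff (N j) ?r) d) k) * z ^ k)"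
      using monic by (simp flip: lessThan_Suc_atMost)
    also have "\<dots> = (\<Sum>k\<le>?r. of_real (coeff (N j) k) * z ^ k) - of_real (coeff (N j) ?r) * (\<Sum>k\<le>?r. of_real (coeff d k) * z ^ k)"
      by (simp add: sum_subtractf sum_distrib_left algebra_simps)
    also have "\<dots> = poly (map_poly of_real (N j)) z - of_real (L $ j) * ?d z"
      by (simp add: polyr[OF deg] polyr[of d ?r] L_def)
    finally show "ss_tf F G H L z $ j = poly (map_poly of_real (N j)) z / ?d z"
      using d0 by (simp add: ss_tf_def cvec_def L_def field_simps)
  qed
qed

section \<open>The Hamiltonian pencil\<close>

lemma cmat_mult: "cmat (M ** N) = cmat M ** cmat N"
  by (simp add: cmat_def matrix_matrix_mult_def vec_eq_iff)

lemma cmat_diff: "cmat (M - N) = cmat M - cmat N"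
  by (simp add: cmat_def vec_eq_iff)

lemma cmat_transpose: "cmat (transpose M) = adj (cmat M)"
  by (simp add: cmat_def transpose_def adj_def vec_eq_iff)

lemma adj_mult: "adj (M ** N) = adj N ** adj M"
  by (simp add: adj_def matrix_matrix_mult_def vec_eq_iff mult.commute)

lemma adj_adj [simp]: "adj (adj M) = M"
  by (simp add: adj_def vec_eq_iff)

lemma adj_diff: "adj (M - N) = adj M - adj N"
  by (simp add: adj_def vec_eq_iff)

lemma adj_mat [simp]: "adj (mat z) = mat (cnj z)"
  by (auto simp: adj_def mat_def vec_eq_iff)

lemma matrix_diff_ldistrib: "M ** (N - P) = M ** N - M ** (P :: 'a::ring_1^'k^'n)"
  by (simp add: matrix_matrix_mult_def vec_eq_iff sum_subtractf right_diff_distrib)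

lemma matrix_add_rdistrib: "(M + N) ** P = M ** P + N ** (P :: 'a::semiring_1^'k^'n)"
  by (simp add: matrix_matrix_mult_def vec_eq_iff sum.distrib distrib_right)

lemma mat_mult_vec: "mat z *v x = (z :: 'a :: comm_ring_1) *s x"
  by (simp add: vec_eq_iff mat_def matrix_vector_mult_def if_distrib if_distribR cong: if_cong)

lemma matrix_mult_smult_vec: "M *v (c *s x) = c *s (M *v x)" for c :: "'a :: comm_ring_1"
  by (simp add: vec_eq_iff matrix_vector_mult_def sum_distrib_left mult_ac)

definition cip :: "complex^'n \<Rightarrow> complex^'n \<Rightarrow> complex" where
  "cip x y = (\<Sum>i\<in>UNIV. x $ i * cnj (y $ i))"

lemma cip_adj: "cip (M *v x) y = cip x (adj M *v y)"
proof -
  have "cip (M *v x) y = (\<Sum>i\<in>UNIV. \<Sum>j\<in>UNIV. M $ i $ j * x $ j * cnj (y $ i))"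
    by (simp add: cip_def matrix_vector_mult_def sum_distrib_right)
  also have "\<dots> = (\<Sum>j\<in>UNIV. \<Sum>i\<in>UNIV. M $ i $ j * x $ j * cnj (y $ i))"
    by (rule sum.swap)
  also have "\<dots> = cip x (adj M *v y)"
    by (simp add: cip_def matrix_vector_mult_def adj_def sum_distrib_left mult_ac)
  finally show ?thesis .
qed

lemma cip_self: "cip x x = of_real (\<Sum>i\<in>UNIV. (cmod (x $ i))\<^sup>2)"
  unfolding cip_def of_real_sum complex_norm_square ..

lemma cip_self_sum_zero:
  assumes "cip x x + cip y y = 0"
  shows "x = 0 \<and> y = 0"
proof -
  have "(\<Sum>i\<in>UNIV. (cmod (x $ i))\<^sup>2) + (\<Sum>i\<in>UNIV. (cmod (y $ i))\<^sup>2) = 0"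
    using assms unfolding cip_self by (metis of_real_add of_real_eq_0_iff)
  moreover have "(\<Sum>i\<in>UNIV. (cmod (x $ i))\<^sup>2) \<ge> 0" "(\<Sum>i\<in>UNIV. (cmod (y $ i))\<^sup>2) \<ge> 0"
    by (simp_all add: sum_nonneg)
  ultimately have "(\<Sum>i\<in>UNIV. (cmod (x $ i))\<^sup>2) = 0" "(\<Sum>i\<in>UNIV. (cmod (y $ i))\<^sup>2) = 0"
    by linarith+
  thus ?thesis by (simp add: sum_nonneg_eq_0_iff vec_eq_iff)
qed

section \<open>Determinants of polynomial matrices\<close>

lemma poly_det: "poly (det M) z = det (\<chi> i j. poly (M $ i $ j) z)"
  for M :: "'a::comm_ring_1 poly^'n^'n"
  by (simp add: det_def poly_sum poly_prod poly_of_int of_int_poly)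

lemma degree_det_le:
  fixes M :: "'a::idom poly^'n^'n"
  assumes "\<And>i j. degree (M $ i $ j) \<le> 1"
  shows "degree (det M) \<le> CARD('n)"
  unfolding det_def
proof (rule degree_sum_le)
  fix p :: "'n \<Rightarrow> 'n"
  have "degree (\<Prod>i\<in>UNIV. M $ i $ p i) \<le> (\<Sum>i\<in>UNIV. degree (M $ i $ p i))"
    using degree_prod_sum_le[of UNIV "\<lambda>i. M $ i $ p i"] by (simp add: o_def)
  also have "\<dots> \<le> (\<Sum>i::'n\<in>UNIV. 1)" by (intro sum_mono assms)
  finally have "degree (\<Prod>i\<in>UNIV. M $ i $ p i) \<le> CARD('n)" by simp
  moreover have "degree (of_int (sign p) :: 'a poly) = 0" by simp
  ultimately show "degree (of_int (sign p) * (\<Prod>i\<in>UNIV. M $ i $ p i)) \<le> CARD('n)"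
    using degree_mult_le[of "of_int (sign p)" "\<Prod>i\<in>UNIV. M $ i $ p i"] by linarith
qed (simp add: finite_permutations)

lemma det_cnj: "det (\<chi> i j. cnj (M $ i $ j)) = cnj (det M)"
  by (simp add: det_def)

lemma poly_det_cnj:
  assumes "\<And>i j z. poly (M $ i $ j) (cnj z) = cnj (poly (M $ i $ j) z)"
  shows "poly (det M) (cnj z) = cnj (poly (det M) z)"
  unfolding poly_det assms using det_cnj[of "\<chi> i j. poly (M $ i $ j) z"] by simp

text \<open>The eigenvalues are roots of the characteristic polynomial. It is not identically zero,
  because a number above a bound \<open>K\<close> for the operator norm is no eigenvalue.\<close>

lemma finite_eigenvalues: "finite {z. \<not> invertible (mat z - M)}" for M :: "complex^'n^'n"
proof -
  let ?P = "\<chi> i j. [:- M $ i $ j, if i = j then 1 else 0:]"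
  have P: "poly (det ?P) z = det (mat z - M)" for z
    unfolding poly_det by (rule arg_cong[of _ _ det]) (auto simp: vec_eq_iff mat_def)
  obtain K where K: "\<And>x. norm (M *v x) \<le> norm x * K"
    using bounded_linear.bounded[OF matrix_vector_mul_bounded_linear[of M]] by blast
  have "invertible (mat (of_real (\<bar>K\<bar> + 1)) - M)"
    unfolding invertible_iff_kernel
  proof (intro allI impI)
    fix x assume "(mat (of_real (\<bar>K\<bar> + 1)) - M) *v x = 0"
    hence "M *v x = mat (of_real (\<bar>K\<bar> + 1)) *v x"
      by (simp only: matrix_vector_mult_diff_rdistrib right_minus_eq)
    also have "\<dots> = (\<bar>K\<bar> + 1) *\<^sub>R x"
      by (simp add: mat_mult_vec vec_eq_iff) (simp add: scaleR_conv_of_real algebra_simps)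
    finally have "\<bar>K\<bar> * norm x + norm x \<le> norm x * K" using K[of x] by (simp add: distrib_right)
    moreover have "norm x * K \<le> \<bar>K\<bar> * norm x"
      by (metis abs_ge_self mult.commute mult_right_mono norm_ge_zero)
    ultimately have "norm x \<le> 0" by linarith
    thus "x = 0" by simp
  qed
  hence "poly (det ?P) (of_real (\<bar>K\<bar> + 1)) \<noteq> 0"
    unfolding P invertible_det_nz .
  hence "det ?P \<noteq> 0" by (metis poly_0)
  hence "finite {z. poly (det ?P) z = 0}" by (rule poly_roots_finite)
  thus ?thesis unfolding P invertible_det_nz by simp
qed

section \<open>Hautus tests and the kernel of the pencil\<close>

lemma detectable_kernel:
  assumes "detectable A C" "cmod z = 1" "(mat z - cmat A) *v x = 0" "cmat C *v x = 0"
  shows "x = 0"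
proof -
  obtain G where G: "schur_stable (A - G ** C)" using assms(1) by (auto simp: detectable_def)
  \<comment> \<open>Output injection is invisible on vectors annihilated by
    \<open>C\<close>.\<close>
  have "(mat z - cmat (A - G ** C)) *v x = (mat z - cmat A) *v x + cmat G *v (cmat C *v x)"
    by (simp add: cmat_diff cmat_mult matrix_vector_mult_diff_rdistrib matrix_vector_mul_assoc)
  hence "(mat z - cmat (A - G ** C)) *v x = 0" using assms(3,4) by simp
  moreover have "1 \<le> cmod z" using assms(2) by simp
  ultimately show ?thesis
    using G unfolding schur_stable_def invertible_iff_kernel by blast
qed

text \<open>An eigenvector of the adjoint that is annihilated by the adjoint of \<open>B\<close> is
  annihilated by those of all \<open>matpow A k ** B\<close>, hence orthogonal to the whole
  controllable space.\<close>

lemma controllable_kernel: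
  fixes A :: "real^'n^'n" and B :: "real^'w^'n"
  assumes "controllable A B" "(mat w - adj (cmat A)) *v x = 0" "adj (cmat B) *v x = 0"
  shows "x = 0"
proof -
  have Ax: "adj (cmat A) *v x = w *s x"
    using assms(2) by (simp add: matrix_vector_mult_diff_rdistrib mat_mult_vec)
  have pow: "adj (cmat (matpow A k)) *v x = w ^ k *s x" for k
  proof (induction k)
    case 0
    have "cmat (mat 1 :: real^'n^'n) = mat 1" by (simp add: cmat_def mat_def vec_eq_iff)
    thus ?case by simp
  next
    case (Suc k)
    have "adj (cmat (matpow A (Suc k))) *v x = adj (cmat (matpow A k)) *v (adj (cmat A) *v x)"
      by (simp add: cmat_mult adj_mult matrix_vector_mul_assoc)
    thus ?case using Suc by (simp add: Ax matrix_mult_smult_vec vector_smult_assoc)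
  qed
  have z: "adj (cmat (matpow A k ** B)) *v x = 0" for k
    by (simp add: cmat_mult adj_mult flip: matrix_vector_mul_assoc)
       (simp add: pow matrix_mult_smult_vec assms(3))
  have col: "(\<Sum>i\<in>UNIV. of_real (column j (matpow A k ** B) $ i) * x $ i) = 0" for j k
  proof -
    have "(adj (cmat (matpow A k ** B)) *v x) $ j = 0" by (simp add: z)
    thus ?thesis by (simp add: matrix_vector_mult_def adj_def cmat_def column_def)
  qed
  have orth: "u = 0" if u: "\<And>j k. u \<bullet> column j (matpow A k ** B) = 0" for u
  proof -
    have "span (\<Union>k\<in>{..<CARD('n)}. range (\<lambda>j. column j (matpow A k ** B))) \<subseteq> {v. u \<bullet> v = 0}"
      by (rule span_minimal) (use u in \<open>auto simp: subspace_hyperplane\<close>)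
    hence "u \<in> {v. u \<bullet> v = 0}" using assms(1) unfolding controllable_def by blast
    thus ?thesis by simp
  qed
  \<comment> \<open>Controllability concerns a real span, so real and imaginary parts are treated
    separately.\<close>
  have "(\<chi> i. Re (x $ i)) = 0"
    by (rule orth) (use arg_cong[OF col, of Re] in \<open>simp add: inner_vec_def mult.commute\<close>)
  moreover have "(\<chi> i. Im (x $ i)) = 0"
    by (rule orth) (use arg_cong[OF col, of Im] in \<open>simp add: inner_vec_def mult.commute\<close>)
  ultimately show ?thesis by (simp add: vec_eq_iff complex_eq_iff)
qed

text \<open>An energy identity: pairing the first equation with \<open>y\<close> and moving
  \<open>zI - A\<close> to the other side turns the squared norm of \<open>adj B y\<close> into
  minus that of \<open>C x\<close>. Both vanish, and the two Hautus tests apply.\<close>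

lemma pencil_kernel:
  fixes A :: "real^'n^'n" and B :: "real^'w^'n" and C :: "real^'n^'y"
  assumes "detectable A C" "controllable A B" "cmod z = 1"
    and 1: "(mat z - cmat A) *v x = cmat (B ** transpose B) *v y"
    and 2: "cmat (transpose C ** C) *v x + (mat (cnj z) - adj (cmat A)) *v y = 0"
  shows "x = 0" "y = 0"
proof -
  have "cip (adj (cmat B) *v y) (adj (cmat B) *v y) = cip ((mat z - cmat A) *v x) y"
    unfolding 1 by (simp add: cmat_mult cmat_transpose cip_adj flip: matrix_vector_mul_assoc)
  also have "\<dots> = cip x ((mat (cnj z) - adj (cmat A)) *v y)"
    by (simp add: cip_adj adj_diff)
  also have "(mat (cnj z) - adj (cmat A)) *v y = - (cmat (transpose C ** C) *v x)"
    using 2 by (simp add: add_eq_0_iff)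
  also have "cip x \<dots> = - cip (cmat C *v x) (cmat C *v x)"
    by (simp add: cmat_mult cmat_transpose cip_adj flip: matrix_vector_mul_assoc)
       (simp add: cip_def sum_negf)
  finally have "cip (adj (cmat B) *v y) (adj (cmat B) *v y) + cip (cmat C *v x) (cmat C *v x) = 0"
    by simp
  hence z: "adj (cmat B) *v y = 0" "cmat C *v x = 0" by (auto dest: cip_self_sum_zero)
  have "(mat z - cmat A) *v x = 0"
    unfolding 1 using z by (simp add: cmat_mult cmat_transpose flip: matrix_vector_mul_assoc)
  thus "x = 0" using detectable_kernel assms z by blast
  have "(mat (cnj z) - adj (cmat A)) *v y = 0"
    using 2 z by (simp add: cmat_mult flip: matrix_vector_mul_assoc)
  thus "y = 0" using controllable_kernel assms z by blast
qed

text \<open>The Hamiltonian pencil with blocks \<open>zI - A\<close>, \<open>-BB\<^sup>T\<close>, \<open>C\<^sup>TC\<close>, \<open>z\<^sup>-\<^sup>1I - A\<^sup>T\<close>, its lower block row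
  multiplied by \<open>z\<close> to make the entries polynomial.\<close>

definition pencil :: "real^'n^'n \<Rightarrow> real^'w^'n \<Rightarrow> real^'n^'y \<Rightarrow> complex poly^('n + 'n)^('n + 'n)" where
  "pencil A B C = (\<chi> i j. case i of
     Inl a \<Rightarrow> (case j of
        Inl b \<Rightarrow> [:- of_real (A $ a $ b), if a = b then 1 else 0:]
      | Inr b \<Rightarrow> [:- of_real ((B ** transpose B) $ a $ b):])
   | Inr a \<Rightarrow> (case j of
        Inl b \<Rightarrow> [:0, of_real ((transpose C ** C) $ a $ b):]
      | Inr b \<Rightarrow> [:if a = b then 1 else 0, - of_real (A $ b $ a):]))"

definition pencil_at :: "real^'n^'n \<Rightarrow> real^'w^'n \<Rightarrow> real^'n^'y \<Rightarrow> complex \<Rightarrow> complex^('n + 'n)^('n + 'n)" where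
  "pencil_at A B C z = (\<chi> i j. poly (pencil A B C $ i $ j) z)"

lemma sum_UNIV_sum:
  fixes f :: "'a::finite + 'b::finite \<Rightarrow> 'c::comm_monoid_add"
  shows "(\<Sum>i\<in>UNIV. f i) = (\<Sum>a\<in>UNIV. f (Inl a)) + (\<Sum>b\<in>UNIV. f (Inr b))"
  unfolding UNIV_Plus_UNIV[symmetric] by (subst sum.Plus) auto

text \<open>On the circle the factor \<open>1/z\<close> in the lower block row is
  \<open>cnj z\<close>, so that row becomes \<open>z\<close> times an equation with the adjoint of
  \<open>zI - A\<close>.\<close>

lemma pencil_at_mult:
  assumes "z \<noteq> 0" "inverse z = cnj z"
  shows "pencil_at A B C z *v w = (\<chi> i. case i of
      Inl a \<Rightarrow> ((mat z - cmat A) *v (\<chi> a. w $ Inl a) - cmat (B ** transpose B) *v (\<chi> a. w $ Inr a)) $ a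
    | Inr a \<Rightarrow> z * (cmat (transpose C ** C) *v (\<chi> a. w $ Inl a) + (mat (cnj z) - adj (cmat A)) *v (\<chi> a. w $ Inr a)) $ a)"
proof -
  have "(pencil_at A B C z *v w) $ Inl a =
    ((mat z - cmat A) *v (\<chi> a. w $ Inl a) - cmat (B ** transpose B) *v (\<chi> a. w $ Inr a)) $ a" for a
    unfolding matrix_vector_mult_def[of "pencil_at A B C z"] sum_UNIV_sum vec_lambda_beta
    by (auto simp: pencil_at_def pencil_def matrix_vector_mult_def cmat_def mat_def sum_negf
        intro!: arg_cong2[of _ _ _ _ "(-)"] sum.cong)
  moreover have "(pencil_at A B C z *v w) $ Inr a =
    z * (cmat (transpose C ** C) *v (\<chi> a. w $ Inl a) + (mat (cnj z) - adj (cmat A)) *v (\<chi> a. w $ Inr a)) $ a" for a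
    unfolding matrix_vector_mult_def[of "pencil_at A B C z"] sum_UNIV_sum vec_lambda_beta
    using assms(1)
    by (auto simp: pencil_at_def pencil_def matrix_vector_mult_def cmat_def mat_def adj_def
        distrib_left sum_distrib_left algebra_simps assms(2)[symmetric] intro!: arg_cong2[of _ _ _ _ "(+)"] sum.cong)
  ultimately show ?thesis by (simp add: vec_eq_iff split: sum.split)
qed

lemma degree_det_pencil: "degree (det (pencil A B C)) \<le> 2 * CARD('n)"
  for A :: "real^'n^'n"
proof -
  have "degree (pencil A B C $ i $ j) \<le> 1" for i j
    by (auto simp: pencil_def split: sum.split)
  hence "degree (det (pencil A B C)) \<le> CARD('n + 'n)" by (rule degree_det_le)
  thus ?thesis by (simp add: card_UNIV_sum)
qed

lemma pencil_cnj: "poly (pencil A B C $ i $ j) (cnj z) = cnj (poly (pencil A B C $ i $ j) z)"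
  by (auto simp: pencil_def split: sum.split)

lemma det_pencil_at: "poly (det (pencil A B C)) z = det (pencil_at A B C z)"
  by (simp add: poly_det pencil_at_def)

text \<open>Scaling \<open>zM(1/z)\<close> by \<open>diag(z, 1)\<close> on one side and its inverse on the other, and swapping the two
  blocks, yields the transpose of \<open>M(z)\<close>.\<close>

lemma det_pencil_reciprocal:
  fixes A :: "real^'n^'n"
  assumes z: "z \<noteq> 0"
  shows "poly (det (pencil A B C)) z = z ^ (2 * CARD('n)) * poly (det (pencil A B C)) (inverse z)"
proof -
  let ?M = "pencil_at A B C z" and ?N = "pencil_at A B C (inverse z)"
  define t :: "'n + 'n \<Rightarrow> 'n + 'n" where "t i = (case i of Inl a \<Rightarrow> Inr a | Inr a \<Rightarrow> Inl a)" for i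
  define s :: "'n + 'n \<Rightarrow> complex" where "s i = (case i of Inl a \<Rightarrow> z | Inr a \<Rightarrow> 1)" for i
  have tt: "t (t i) = i" for i by (simp add: t_def split: sum.split)
  have t: "t permutes UNIV" unfolding permutes_def using tt by (metis iso_tuple_UNIV_I)
  have s: "prod s UNIV \<noteq> 0" using z by (auto simp: s_def split: sum.split)
  have symB: "(B ** transpose B) $ a $ b = (B ** transpose B) $ b $ a" for a b
    by (simp add: matrix_matrix_mult_def transpose_def mult.commute)
  have symC: "(transpose C ** C) $ a $ b = (transpose C ** C) $ b $ a" for a b
    by (simp add: matrix_matrix_mult_def transpose_def mult.commute)
  have key: "z * ?N $ i $ j * s j = s i * ?M $ t j $ t i" for i j
    using z symB symC
    by (cases i; cases j) (auto simp: pencil_at_def pencil_def s_def t_def field_simps)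
  have "prod s UNIV * (z ^ (2 * CARD('n)) * det ?N) = prod s UNIV * det (\<chi> i. z *s ?N $ i)"
    by (subst det_rows_mul) (simp add: card_UNIV_sum vec_lambda_eta mult_2)
  also have "\<dots> = prod s UNIV * det (transpose (\<chi> i. z *s ?N $ i))" by simp
  also have "\<dots> = det (\<chi> j. s j *s transpose (\<chi> i. z *s ?N $ i) $ j)"
    by (subst det_rows_mul) (simp add: vec_lambda_eta)
  also have "(\<chi> j. s j *s transpose (\<chi> i. z *s ?N $ i) $ j) = transpose (\<chi> i j. z * ?N $ i $ j * s j)"
    by (simp add: transpose_def vec_eq_iff mult.commute)
  also have "(\<chi> i j. z * ?N $ i $ j * s j) = (\<chi> i. s i *s (\<chi> j. ?M $ t j $ t i))"
    unfolding key by (simp add: vec_eq_iff)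
  also have "det (transpose (\<chi> i. s i *s (\<chi> j. ?M $ t j $ t i))) = prod s UNIV * det (\<chi> i j. ?M $ t j $ t i)"
    by (simp add: det_rows_mul)
  also have "(\<chi> i j. ?M $ t j $ t i) = transpose (\<chi> i. (\<chi> i j. ?M $ i $ t j) $ t i)"
    by (simp add: transpose_def vec_eq_iff)
  \<comment> \<open>The block swap acts on rows and on columns, so its sign enters squared.\<close>
  also have "det \<dots> = of_int (sign t) * (of_int (sign t) * det ?M)"
    by (simp only: det_transpose det_permute_rows[OF t] det_permute_columns[OF t])
  also have "\<dots> = det ?M" by (simp flip: mult.assoc of_int_mult)
  finally show ?thesis using s by (simp add: det_pencil_at)
qed

text \<open>Cramer's rule for the upper block of the solution of \<open>M(z) (\<xi>, \<eta>) = (0, z C\<^sup>T e\<^sub>k)\<close>.\<close>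

definition pencil_num :: "real^'n^'n \<Rightarrow> real^'w^'n \<Rightarrow> real^'n^'y \<Rightarrow> 'n \<Rightarrow> 'y \<Rightarrow> complex poly" where
  "pencil_num A B C j k = det (\<chi> i l. if l = Inl j
     then (case i of Inl a \<Rightarrow> 0 | Inr a \<Rightarrow> [:0, of_real (C $ k $ a):])
     else pencil A B C $ i $ l)"

definition pencil_sol :: "real^'n^'n \<Rightarrow> real^'w^'n \<Rightarrow> real^'n^'y \<Rightarrow> complex \<Rightarrow> complex^'y^'n" where
  "pencil_sol A B C z = (\<chi> j k. poly (pencil_num A B C j k) z / poly (det (pencil A B C)) z)"

lemma pencil_num_cnj: "poly (pencil_num A B C j k) (cnj z) = cnj (poly (pencil_num A B C j k) z)"
  unfolding pencil_num_def
  by (rule poly_det_cnj) (auto simp: pencil_cnj split: sum.split)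

lemma det_pencil_cnj: "poly (det (pencil A B C)) (cnj z) = cnj (poly (det (pencil A B C)) z)"
  by (rule poly_det_cnj) (rule pencil_cnj)

lemma det_pencil_nonzero:
  assumes "detectable A C" "controllable A B" "cmod z = 1"
  shows "poly (det (pencil A B C)) z \<noteq> 0"
proof -
  have "invertible (pencil_at A B C z)"
    unfolding invertible_iff_kernel
  proof (intro allI impI)
    fix w assume w: "pencil_at A B C z *v w = 0"
    have z0: "z \<noteq> 0" using assms(3) by auto
    note e = w[unfolded pencil_at_mult[OF unit_circle_inverse[OF assms(3)]] vec_eq_iff, rule_format]
    have 1: "(mat z - cmat A) *v (\<chi> a. w $ Inl a) = cmat (B ** transpose B) *v (\<chi> a. w $ Inr a)"
      unfolding vec_eq_iff using e[of "Inl _"] by simp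
    have 2: "cmat (transpose C ** C) *v (\<chi> a. w $ Inl a) + (mat (cnj z) - adj (cmat A)) *v (\<chi> a. w $ Inr a) = 0"
      unfolding vec_eq_iff using e[of "Inr _"] z0 by simp
    have "(\<chi> a. w $ Inl a) = 0" "(\<chi> a. w $ Inr a) = 0"
      using pencil_kernel[OF assms 1 2] by auto
    thus "w = 0" unfolding vec_eq_iff by (metis (no_types) sumE vec_lambda_beta zero_index)
  qed
  thus ?thesis by (simp add: det_pencil_at invertible_det_nz)
qed

text \<open>\<open>Y\<close> collects the lower blocks of the solutions, the costates. It stays
  anonymous because the applications eliminate it.\<close>

lemma pencil_sol:
  fixes A :: "real^'n^'n" and B :: "real^'w^'n" and C :: "real^'n^'y"
  assumes "detectable A C" "controllable A B" "cmod z = 1"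
  obtains Y :: "complex^'y^'n"
  where "(mat z - cmat A) ** pencil_sol A B C z = cmat (B ** transpose B) ** Y"
    "cmat (transpose C ** C) ** pencil_sol A B C z + (mat (cnj z) - adj (cmat A)) ** Y = cmat (transpose C)"
proof -
  let ?M = "pencil_at A B C z"
  define r :: "'y \<Rightarrow> complex^('n + 'n)" where
    "r k = (\<chi> i. case i of Inl a \<Rightarrow> 0 | Inr a \<Rightarrow> z * of_real (C $ k $ a))" for k
  define w where "w k = (\<chi> l. det (\<chi> i j. if j = l then r k $ i else ?M $ i $ j) / det ?M)" for k
  define Y :: "complex^'y^'n" where "Y = (\<chi> j k. w k $ Inr j)"
  have M: "det ?M \<noteq> 0" using det_pencil_nonzero[OF assms] by (simp add: det_pencil_at)
  have z0: "z \<noteq> 0" using assms(3) by auto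
  have w: "?M *v w k = r k" for k
    using cramer[OF M, of "w k" "r k"] by (simp add: w_def)
  have X: "pencil_sol A B C z $ j $ k = w k $ Inl j" for j k
    unfolding pencil_sol_def pencil_num_def w_def poly_det det_pencil_at[symmetric]
    by (auto simp: r_def pencil_at_def poly_det vec_eq_iff if_distrib if_distribR
        intro!: arg_cong2[of _ _ _ _ "(/)"] arg_cong[of _ _ det] split: sum.split)
  note e = w[unfolded pencil_at_mult[OF unit_circle_inverse[OF assms(3)]] vec_eq_iff, rule_format]
  have colX: "((N :: complex^'n^'n) ** pencil_sol A B C z) $ a $ k = (N *v (\<chi> a. w k $ Inl a)) $ a" for N a k
    by (simp add: matrix_matrix_mult_def matrix_vector_mult_def X)
  have colY: "((N :: complex^'n^'n) ** Y) $ a $ k = (N *v (\<chi> a. w k $ Inr a)) $ a" for N a k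
    by (simp add: matrix_matrix_mult_def matrix_vector_mult_def Y_def)
  show ?thesis
  proof
    show "(mat z - cmat A) ** pencil_sol A B C z = cmat (B ** transpose B) ** Y"
      unfolding vec_eq_iff colX colY using e[of _ "Inl _"] by (simp add: r_def)
    show "cmat (transpose C ** C) ** pencil_sol A B C z + (mat (cnj z) - adj (cmat A)) ** Y = cmat (transpose C)"
      unfolding vec_eq_iff vector_add_component colX colY using e[of _ "Inr _"] z0
      by (simp add: r_def cmat_def transpose_def)
  qed
qed

text \<open>With \<open>X\<close> the inverse of \<open>zI - A\<close>, the lower equation gives
  \<open>Y = adj X adj C R\<close> and the upper one then \<open>Xi = X B adj H R\<close>, where
  \<open>Xi\<close> is the pencil solution. Hence \<open>C Xi = H adj H R\<close>, so that
  \<open>R + C Xi = I\<close> says that \<open>R\<close> inverts the spectral density, and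
  \<open>Cs Xi = L adj H R\<close> is the Wiener estimator.\<close>

lemma wiener_estimator_pencil:
  fixes A :: "real^'n^'n" and B :: "real^'w^'n" and C :: "real^'n^'y"
  assumes "detectable A C" "controllable A B" "cmod z = 1" "invertible (mat z - cmat A)"
  defines "R \<equiv> mat 1 - cmat C ** pencil_sol A B C z"
  shows "(mat 1 + Htf A B C z ** adj (Htf A B C z)) ** R = mat 1"
    and "Kwiener A B C Cs z = cvec Cs v* pencil_sol A B C z"
proof -
  let ?X = "matrix_inv (mat z - cmat A)" and ?H = "Htf A B C z" and ?S = "pencil_sol A B C z"
  obtain Y where 1: "(mat z - cmat A) ** ?S = cmat (B ** transpose B) ** Y"
    and 2: "cmat (transpose C ** C) ** ?S + (mat (cnj z) - adj (cmat A)) ** Y = cmat (transpose C)"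
    using pencil_sol[OF assms(1-3)] by blast
  note X = invertible_matrix_inv[OF assms(4)]
  have aX: "adj ?X ** (mat (cnj z) - adj (cmat A)) = mat 1"
    using arg_cong[OF X(1), of adj] by (simp add: adj_mult adj_diff)
  have "?S = ?X ** ((mat z - cmat A) ** ?S)" by (simp add: matrix_mul_assoc X)
  hence S: "?S = ?X ** cmat B ** adj (cmat B) ** Y"
    unfolding 1 by (simp add: cmat_mult cmat_transpose matrix_mul_assoc)
  have "(mat (cnj z) - adj (cmat A)) ** Y = adj (cmat C) ** R"
    using 2 by (simp add: R_def cmat_mult cmat_transpose matrix_mul_assoc matrix_diff_ldistrib eq_diff_eq add.commute)
  hence "adj ?X ** (mat (cnj z) - adj (cmat A)) ** Y = adj ?X ** adj (cmat C) ** R"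
    by (simp flip: matrix_mul_assoc)
  hence Y: "Y = adj ?X ** adj (cmat C) ** R" by (simp add: aX)
  have SH: "?S = ?X ** cmat B ** adj ?H ** R"
    by (subst S, subst Y) (simp add: Htf_def adj_mult matrix_mul_assoc)
  hence "cmat C ** ?S = ?H ** adj ?H ** R"
    by (simp add: Htf_def matrix_mul_assoc)
  thus I: "(mat 1 + ?H ** adj ?H) ** R = mat 1"
    by (simp add: R_def matrix_add_rdistrib)
  have "matrix_inv (mat 1 + ?H ** adj ?H) = R"
  proof -
    have "invertible (mat 1 + ?H ** adj ?H)" using I invertible_right_inverse by blast
    note J = invertible_matrix_inv(2)[OF this]
    have "matrix_inv (mat 1 + ?H ** adj ?H) ** ((mat 1 + ?H ** adj ?H) ** R) = R"
      by (simp only: matrix_mul_assoc J matrix_mul_lid)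
    thus ?thesis using I by simp
  qed
  thus "Kwiener A B C Cs z = cvec Cs v* ?S"
    by (subst SH) (simp add: Kwiener_def Ltf_def vector_matrix_mul_assoc matrix_mul_assoc)
qed

text \<open>For the right-hand side belonging to \<open>C v\<close>, the pair \<open>(v, 0)\<close>
  solves the pencil equations as well. The solution is unique, so \<open>Xi\<close> maps
  \<open>C v\<close> to \<open>v\<close>.\<close>

lemma pencil_sol_eigenvector:
  fixes A :: "real^'n^'n" and B :: "real^'w^'n" and C :: "real^'n^'y"
  assumes "detectable A C" "controllable A B" "cmod z = 1" "(mat z - cmat A) *v v = 0"
  shows "(mat 1 - cmat C ** pencil_sol A B C z) *v (cmat C *v v) = 0"
proof -
  let ?S = "pencil_sol A B C z"
  obtain Y where 1: "(mat z - cmat A) ** ?S = cmat (B ** transpose B) ** Y"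
    and 2: "cmat (transpose C ** C) ** ?S + (mat (cnj z) - adj (cmat A)) ** Y = cmat (transpose C)"
    using pencil_sol[OF assms(1-3)] by blast
  let ?u = "cmat C *v v"
  have "(mat z - cmat A) *v (?S *v ?u - v) = cmat (B ** transpose B) *v (Y *v ?u)"
    using arg_cong[OF 1, of "\<lambda>M. M *v ?u"] assms(4)
    by (simp add: matrix_vector_mult_diff_distrib flip: matrix_vector_mul_assoc)
  moreover have "cmat (transpose C ** C) *v (?S *v ?u - v) + (mat (cnj z) - adj (cmat A)) *v (Y *v ?u) = 0"
    using arg_cong[OF 2, of "\<lambda>M. M *v ?u"]
    by (simp add: matrix_vector_mult_diff_distrib matrix_vector_mult_add_rdistrib cmat_mult
        algebra_simps flip: matrix_vector_mul_assoc)
  ultimately have "?S *v ?u - v = 0"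
    by (rule pencil_kernel(1)[OF assms(1-3)])
  thus ?thesis
    by (simp add: matrix_vector_mult_diff_rdistrib flip: matrix_vector_mul_assoc)
qed

section \<open>The filter\<close>

lemma mat_mult_component: "(mat c ** M) $ i $ j = (c :: complex) * M $ i $ j"
  by (simp add: matrix_matrix_mult_def mat_def if_distrib if_distribR cong: if_cong)

lemma mat_mult_commute: "mat c ** (M ** N) = M ** (mat (c :: complex) ** N)"
proof -
  have "(mat c ** (M ** N)) $ i $ j = (M ** (mat c ** N)) $ i $ j" for i j
    unfolding mat_mult_component matrix_matrix_mult_def[of M] vec_lambda_beta
    by (simp add: sum_distrib_left mult.left_commute)
  thus ?thesis by (simp add: vec_eq_iff)
qed

lemma smult_vector_matrix_mult: "(c *s x) v* M = c *s (x v* M)" for c :: complex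
  by (simp add: vec_eq_iff vector_matrix_mult_def sum_distrib_left mult.assoc)

lemma vector_matrix_mult_mat: "x v* (mat c ** M) = c *s (x v* M)" for c :: complex
  by (simp add: vec_eq_iff vector_matrix_mult_def mat_mult_component sum_distrib_left mult_ac)

lemma ratfun_pencil_sol:
  assumes "detectable A C" "controllable A B"
  shows "ratfun (\<lambda>z. pencil_sol A B C z $ j $ k)"
  unfolding ratfun_def
  by (rule exI[of _ "pencil_num A B C j k"], rule exI[of _ "det (pencil A B C)"])
     (use det_pencil_nonzero[OF assms] in \<open>auto simp: pencil_sol_def\<close>)

text \<open>A priori \<open>A\<close> may have eigenvalues on the unit circle, where \<open>Htf\<close> is a junk value. The identity
  \<open>D D\<^sup>* R = I\<close> extends there by continuity, whereas an eigenvector \<open>v\<close> would satisfy \<open>R (C v) = 0\<close>.\<close>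

lemma spectral_factor_inverse:
  fixes A :: "real^'n^'n" and B :: "real^'w^'n" and Cy :: "real^'n^'y" and D
  assumes det: "detectable A Cy" and ctrb: "controllable A B" and Delta: "canonical_Delta A B Cy D"
    and z: "cmod z = 1"
  defines "R \<equiv> \<lambda>z. mat 1 - cmat Cy ** pencil_sol A B Cy z"
  shows "invertible (mat z - cmat A)" "D z ** (adj (D z) ** R z) = mat 1"
proof -
  have D: "mwiener UNIV D"
    using Delta by (auto simp: canonical_Delta_def mratfun_def mwiener_def intro: wiener_ratfun)
  have S: "mwiener UNIV (pencil_sol A B Cy)"
    unfolding mwiener_def using ratfun_pencil_sol[OF det ctrb] wiener_ratfun by blast
  have R: "mwiener UNIV R"
    using mwiener_mult[OF mwiener_const[of UNIV "cmat Cy"] S, of UNIV]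
    by (auto simp: mwiener_def R_def intro!: wiener_diff wiener_const)
  let ?P = "\<lambda>z. D z ** (adj (D z) ** R z)"
  have P: "mwiener UNIV ?P"
    by (rule mwiener_mult[OF D mwiener_mult[OF mwiener_adj[OF D, of UNIV] R, of UNIV]]) auto
  have "?P z $ i $ j = (mat 1 :: complex^'y^'y) $ i $ j" for i j
  proof (rule wiener_eqI_finite[OF _ _ finite_eigenvalues[of "cmat A"] _ z])
    show "wiener UNIV (\<lambda>z. ?P z $ i $ j)" using P by (simp add: mwiener_def)
    show "wiener UNIV (\<lambda>_. (mat 1 :: complex^'y^'y) $ i $ j)" by (rule wiener_const) simp
    fix w :: complex assume w: "cmod w = 1" "w \<notin> {z. \<not> invertible (mat z - cmat A)}"
    hence "D w ** adj (D w) = mat 1 + Htf A B Cy w ** adj (Htf A B Cy w)"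
      using Delta by (simp add: canonical_Delta_def)
    thus "?P w $ i $ j = (mat 1 :: complex^'y^'y) $ i $ j"
      using wiener_estimator_pencil(1)[OF det ctrb w(1)] w(2) by (simp add: matrix_mul_assoc R_def)
  qed
  thus PR: "D z ** (adj (D z) ** R z) = mat 1" by (simp add: vec_eq_iff)
  show "invertible (mat z - cmat A)" unfolding invertible_iff_kernel
  proof (intro allI impI)
    fix v assume v: "(mat z - cmat A) *v v = 0"
    have "cmat Cy *v v = (D z ** (adj (D z) ** R z)) *v (cmat Cy *v v)" by (simp add: PR)
    also have "\<dots> = D z *v (adj (D z) *v (R z *v (cmat Cy *v v)))"
      by (simp add: matrix_vector_mul_assoc matrix_mul_assoc)
    also have "\<dots> = 0"
      unfolding R_def pencil_sol_eigenvector[OF det ctrb z v] by simp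
    finally show "v = 0" using detectable_kernel[OF det z v] by simp
  qed
qed


lemma matrix_inv_unique: "M ** N = mat 1 \<Longrightarrow> matrix_inv M = (N :: 'a::field^'n^'n)"
  by (metis invertible_matrix_inv(2) invertible_right_inverse matrix_mul_assoc matrix_mul_lid matrix_mul_rid)

lemma canonical_U_wiener:
  assumes U: "ratfun U" "canonical_U p q m U"
    and pos: "\<forall>z. cmod z = 1 \<longrightarrow> Re (lpoly p m z) > 0" "\<forall>z. cmod z = 1 \<longrightarrow> Re (lpoly q m z) > 0"
  shows "wiener {..0} U" "wiener {..0} (\<lambda>z. inverse (U z))" "cmod z = 1 \<Longrightarrow> U z \<noteq> 0"
proof -
  have nz: "U z \<noteq> 0" if "cmod z = 1" for z
  proof
    assume "U z = 0"
    hence "lpoly p m z / lpoly q m z = 0"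
      using U(2) that unfolding canonical_U_def by (metis mult_zero_right)
    moreover have "lpoly p m z \<noteq> 0" "lpoly q m z \<noteq> 0" using pos that by force+
    ultimately show False by simp
  qed
  show "wiener {..0} U" "wiener {..0} (\<lambda>z. inverse (U z))"
    using U wiener_ratfun ratfun_inverse[OF U(1) nz] wiener_causal unfolding canonical_U_def by blast+
  show "cmod z = 1 \<Longrightarrow> U z \<noteq> 0" by (rule nz)
qed

context
  fixes A :: "real^'n^'n" and B :: "real^'w^'n" and Cy :: "real^'n^'y" and Cs :: "real^'n"
    and D :: "complex \<Rightarrow> complex^'y^'y" and p q :: "int \<Rightarrow> real" and m :: nat and U :: "complex \<Rightarrow> complex"
  assumes det: "detectable A Cy" and ctrb: "controllable A B" and Delta: "canonical_Delta A B Cy D"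
    and p_sym: "\<forall>k. p (- k) = p k" and q_sym: "\<forall>k. q (- k) = q k"
    and P_pos: "\<forall>z. cmod z = 1 \<longrightarrow> Re (lpoly p m z) > 0"
    and Q_pos: "\<forall>z. cmod z = 1 \<longrightarrow> Re (lpoly q m z) > 0"
    and U: "ratfun U" "canonical_U p q m U"
begin

text \<open>\<open>Xi\<close> is the state response with the plant poles cancelled, \<open>R\<close>
  the inverse of the spectral density, and \<open>E\<close> the inverse of the spectral
  factor.\<close>

abbreviation (input) "Xi \<equiv> pencil_sol A B Cy"
abbreviation (input) "R z \<equiv> mat 1 - cmat Cy ** Xi z"
abbreviation (input) "E z \<equiv> matrix_inv (D z)"
abbreviation (input) "K \<equiv> Kfilt A B Cy Cs D U"

text \<open>Exhibits the causal \<open>E\<close> as an anticausal factor times the rational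
  \<open>R\<close>, whose inner poles a single polynomial can remove.\<close>

lemma inverse_Delta_eq: "cmod z = 1 \<Longrightarrow> E z = adj (D z) ** R z"
  using spectral_factor_inverse(2)[OF det ctrb Delta] by (rule matrix_inv_unique)

lemma Delta_mult_inverse: "cmod z = 1 \<Longrightarrow> D z ** E z = mat 1"
  using spectral_factor_inverse(2)[OF det ctrb Delta] inverse_Delta_eq by simp

lemma inverse_mult_Delta: "cmod z = 1 \<Longrightarrow> E z ** D z = mat 1"
  using Delta_mult_inverse by (simp add: matrix_left_right_inverse)

lemma mwiener_pencil_sol: "mwiener UNIV Xi"
  unfolding mwiener_def using ratfun_pencil_sol[OF det ctrb] wiener_ratfun by blast

lemma mwiener_D: "mwiener {..0} D"
  using Delta unfolding canonical_Delta_def mratfun_def mcausal_def mwiener_def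
  by (blast intro: wiener_causal[OF wiener_ratfun])

lemma mwiener_E: "mwiener {..0} (\<lambda>z. E z)"
proof -
  have "mwiener UNIV (\<lambda>z. R z)"
    using mwiener_mult[OF mwiener_const[of UNIV "cmat Cy"] mwiener_pencil_sol, of UNIV]
    by (auto simp: mwiener_def intro!: wiener_diff wiener_const)
  hence "mwiener UNIV (\<lambda>z. adj (D z) ** R z)"
    by (intro mwiener_mult[OF mwiener_adj[OF mwiener_D, of UNIV]]) auto
  hence "mwiener UNIV (\<lambda>z. E z)" by (rule mwiener_cong) (simp add: inverse_Delta_eq)
  thus ?thesis using Delta wiener_causal
    unfolding mwiener_def canonical_Delta_def mcausal_def by blast
qed

lemma Kwiener_eq: "cmod z = 1 \<Longrightarrow> Kwiener A B Cy Cs z = cvec Cs v* Xi z"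
  using wiener_estimator_pencil(2)[OF det ctrb] spectral_factor_inverse(1)[OF det ctrb Delta] by blast

lemmas U_wiener = canonical_U_wiener[OF U P_pos Q_pos]

text \<open>\<open>S\<close> is the strictly anticausal part of \<open>U\<close> times
  \<open>{K_0 D}_-\<close>; it is also that of \<open>U K_0 D\<close>, since \<open>U\<close> times
  \<open>{K_0 D}_+\<close> is causal. Writing a causal part as the whole minus the anticausal part
  lets the whole recombine to \<open>K_0\<close>, because \<open>D E = I\<close>.\<close>

lemma Kfilt_decomposition:
  obtains S where "vwiener {1..} S" "vwiener {..0} K"
    "\<And>z. cmod z = 1 \<Longrightarrow> K z = cvec Cs v* Xi z - (inverse (U z) *s S z) v* E z"
proof -
  define W where "W z = Kwiener A B Cy Cs z v* D z" for z
  define T where "T = vminus_part W"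
  define V where "V z = U z *s T z" for z
  have K: "K z = (vplus_part W z + inverse (U z) *s vplus_part V z) v* E z" for z
    by (simp add: Kfilt_def KH2_def W_def[abs_def] T_def V_def[abs_def] vector_matrix_left_distrib)
  have "vwiener UNIV (\<lambda>z. cvec Cs v* Xi z)"
    by (rule vwiener_mult[OF vwiener_const[of UNIV] mwiener_pencil_sol]) auto
  hence "vwiener UNIV (Kwiener A B Cy Cs)" by (rule vwiener_cong) (simp add: Kwiener_eq)
  hence W: "vwiener UNIV W" unfolding W_def[abs_def]
    by (rule vwiener_mult[OF _ mwiener_D]) auto
  note Wp = vwiener_parts[OF W]
  have V: "vwiener UNIV V" unfolding V_def[abs_def] T_def
    by (rule vwiener_smult[OF U_wiener(1) Wp(2)]) auto
  note Vp = vwiener_parts[OF V]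
  have "vwiener {..0} (\<lambda>z. inverse (U z) *s vplus_part V z)"
    by (rule vwiener_smult[OF U_wiener(2) Vp(1)]) auto
  hence "vwiener {..0} (\<lambda>z. vplus_part W z + inverse (U z) *s vplus_part V z)"
    by (rule vwiener_add[OF Wp(1)])
  hence K0: "vwiener {..0} K" unfolding K[abs_def]
    by (rule vwiener_mult[OF _ mwiener_E]) auto
  have "K z = cvec Cs v* Xi z - (inverse (U z) *s vminus_part V z) v* E z" if z: "cmod z = 1" for z
  proof -
    have "T z = inverse (U z) *s V z"
      using U_wiener(3)[OF z] by (simp add: V_def vec_eq_iff)
    hence "T z = inverse (U z) *s (vplus_part V z + vminus_part V z)"
      by (simp only: Vp(3)[OF z])
    hence "vplus_part W z + inverse (U z) *s vplus_part V z = W z - inverse (U z) *s vminus_part V z"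
      using Wp(3)[OF z] by (simp add: T_def algebra_simps vector_add_ldistrib)
    thus ?thesis unfolding K
      by (simp add: vector_matrix_mult_diff_distrib W_def vector_matrix_mul_assoc Delta_mult_inverse z Kwiener_eq
          flip: matrix_mul_assoc)
  qed
  thus ?thesis using that Vp(2) K0 by blast
qed

text \<open>\<open>D\<close> and \<open>U\<close> are only unique up to complex unitary factors, so the filter is not visibly real. But it
  is determined by being causal together with \<open>(K\<^sub>0 - K) D D\<^sup>* U U\<^sup>*\<close> being strictly anticausal, and both
  properties are invariant under \<open>K(z) \<mapsto> cnj (K (cnj z))\<close>.\<close>

lemma Kfilt_cnj:
  assumes z: "cmod z = 1"
  shows "K (cnj z) $ j = cnj (K z $ j)"
proof -
  define cm :: "complex^'y^'y \<Rightarrow> complex^'y^'y" where "cm M = (\<chi> i j. cnj (M $ i $ j))" for M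
  define cv :: "complex^'y \<Rightarrow> complex^'y" where "cv x = (\<chi> j. cnj (x $ j))" for x
  have cv_mult: "cv (x v* M) = cv x v* cm M" for x M
    by (simp add: cv_def cm_def vector_matrix_mult_def vec_eq_iff)
  have cv_smult: "cv (a *s x) = cnj a *s cv x" for a x
    by (simp add: cv_def vec_eq_iff)
  have cv_diff: "cv (x - y) = cv x - cv y" for x y
    by (simp add: cv_def vec_eq_iff)
  have cm_mult: "cm (M ** N) = cm M ** cm N" for M N
    by (simp add: cm_def matrix_matrix_mult_def vec_eq_iff)
  have Xi: "Xi (cnj w) $ i $ j = cnj (Xi w $ i $ j)" for w i j
    by (simp add: pencil_sol_def pencil_num_cnj det_pencil_cnj)
  have Rcm: "cm (R (cnj w)) = R w" for w
    by (simp add: cm_def vec_eq_iff Xi matrix_matrix_mult_def cmat_def mat_def)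
  have K0: "cv (cvec Cs v* Xi (cnj w)) = cvec Cs v* Xi w" for w
    by (simp add: cv_def vec_eq_iff Xi vector_matrix_mult_def cvec_def)
  define G where "G w = D w ** adj (D w)" for w
  have GR: "G w ** R w = mat 1" if "cmod w = 1" for w
    using spectral_factor_inverse(2)[OF det ctrb Delta that] by (simp add: G_def matrix_mul_assoc)
  \<comment> \<open>\<open>R\<close> comes from the real pencil and is invariant under the
    reflection; so is its inverse \<open>G\<close>, whatever choice of \<open>D\<close> was
    made.\<close>
  have Gcm: "cm (G (cnj w)) = G w" if w: "cmod w = 1" for w
  proof -
    have "cm (G (cnj w)) ** R w = mat 1"
      using arg_cong[OF GR[of "cnj w"], of cm] w
      by (simp only: cm_mult Rcm) (simp add: cm_def mat_def vec_eq_iff)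
    thus ?thesis using GR[OF w] by (metis matrix_left_right_inverse matrix_mul_assoc matrix_mul_lid matrix_mul_rid)
  qed
  obtain S where S: "vwiener {1..} S" "vwiener {..0} K"
    "\<And>z. cmod z = 1 \<Longrightarrow> K z = cvec Cs v* Xi z - (inverse (U z) *s S z) v* E z"
    by (rule Kfilt_decomposition) (rule that, assumption+)
  define r where "r w = lpoly p m w / lpoly q m w" for w
  have r: "cnj (U w) * U w = r w" if "cmod w = 1" for w
    using U(2) that by (simp add: canonical_U_def r_def)
  have rc: "cnj (r (cnj w)) = r w" if "cmod w = 1" for w
    using that by (simp add: r_def lpoly_real)
  \<comment> \<open>Apart from \<open>K\<close> itself, \<open>V\<close> sees the factors only
    through \<open>G\<close> and \<open>r = P/Q\<close>, which the reflection preserves.\<close>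
  define V where "V w = r w *s ((cvec Cs v* Xi w - K w) v* G w)" for w
  have "V w = cnj (U w) *s (S w v* adj (D w))" if w: "cmod w = 1" for w
  proof -
    have "(cvec Cs v* Xi w - K w) v* G w = (inverse (U w) *s S w) v* ((E w ** D w) ** adj (D w))"
      unfolding S(3)[OF w] G_def by (simp add: vector_matrix_mul_assoc matrix_mul_assoc)
    also have "\<dots> = (inverse (U w) *s S w) v* adj (D w)" by (simp add: inverse_mult_Delta w)
    also have "\<dots> = inverse (U w) *s (S w v* adj (D w))"
      by (rule smult_vector_matrix_mult)
    finally show ?thesis using U_wiener(3)[OF w] by (simp add: V_def r[OF w, symmetric] vec_eq_iff)
  qed
  moreover have "vwiener {1..} (\<lambda>w. cnj (U w) *s (S w v* adj (D w)))"
  proof (rule vwiener_smult[OF wiener_cnj[OF U_wiener(1), of "{0..}"]])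
    show "vwiener {1..} (\<lambda>w. S w v* adj (D w))"
      by (rule vwiener_mult[OF S(1) mwiener_adj[OF mwiener_D, of "{0..}"]]) auto
  qed auto
  ultimately have V: "vwiener {1..} V" by (metis (no_types, lifting) vwiener_cong)
  define K' where "K' w = cv (K (cnj w))" for w
  have K': "vwiener {..0} K'"
    using S(2) by (auto simp: vwiener_def K'_def cv_def intro: wiener_cnj_reflect)
  have "vwiener {1..} (\<lambda>w. cv (V (cnj w)))"
    using V by (auto simp: vwiener_def cv_def intro: wiener_cnj_reflect)
  hence "vwiener {1..} (\<lambda>w. V w - cv (V (cnj w)))" by (intro vwiener_diff V)
  moreover have VV: "V w - cv (V (cnj w)) = r w *s ((K' w - K w) v* G w)" if "cmod w = 1" for w
  proof -
    have "cv (V (cnj w)) = r w *s ((cvec Cs v* Xi w - K' w) v* G w)"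
      by (simp only: V_def cv_smult cv_mult cv_diff K0 K'_def Gcm[OF that] rc[OF that])
    thus ?thesis
      by (simp add: V_def vector_matrix_mult_diff_distrib vec_eq_iff algebra_simps)
  qed
  ultimately have VK: "vwiener {1..} (\<lambda>w. r w *s ((K' w - K w) v* G w))"
    by (rule vwiener_cong)
  \<comment> \<open>Multiplying the strictly anticausal difference by the anticausal adjoints of
    \<open>E\<close> and \<open>inverse U\<close> undoes one half of each factorization. What
    remains is visibly causal as well.\<close>
  let ?d = "\<lambda>w. U w *s ((K' w - K w) v* D w)"
  have "vwiener {1..} (\<lambda>w. cnj (inverse (U w)) *s ((r w *s ((K' w - K w) v* G w)) v* adj (E w)))"
  proof (rule vwiener_smult[OF wiener_cnj[OF U_wiener(2), of "{0..}"]])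
    show "vwiener {1..} (\<lambda>w. (r w *s ((K' w - K w) v* G w)) v* adj (E w))"
      by (rule vwiener_mult[OF VK mwiener_adj[OF mwiener_E, of "{0..}"]]) auto
  qed auto
  hence d1: "vwiener {1..} ?d"
  proof (rule vwiener_cong)
    fix w :: complex assume w: "cmod w = 1"
    have "G w ** adj (E w) = D w ** adj (E w ** D w)"
      by (simp add: G_def adj_mult matrix_mul_assoc)
    hence GE: "G w ** adj (E w) = D w" by (simp add: inverse_mult_Delta w)
    have "(r w *s ((K' w - K w) v* G w)) v* adj (E w) = r w *s (((K' w - K w) v* G w) v* adj (E w))"
      by (rule smult_vector_matrix_mult)
    thus "cnj (inverse (U w)) *s ((r w *s ((K' w - K w) v* G w)) v* adj (E w)) = ?d w"
      using U_wiener(3)[OF w] by (simp add: vector_matrix_mul_assoc GE r[OF w, symmetric] vec_eq_iff)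
  qed
  have "vwiener {..0} (\<lambda>w. (K' w - K w) v* D w)"
    by (rule vwiener_mult[OF vwiener_diff[OF K' S(2)] mwiener_D]) auto
  hence d2: "vwiener {..0} ?d"
    by (rule vwiener_smult[OF U_wiener(1)]) auto
  have "?d z $ i = 0" for i
    by (rule wiener_zero[of "{1..}" "\<lambda>z. ?d z $ i" "{..0}"]) (use d1 d2 z in \<open>auto simp: vwiener_def\<close>)
  hence "(K' z - K z) v* D z = 0" using U_wiener(3)[OF z] by (simp add: vec_eq_iff)
  hence "(K' z - K z) v* (D z ** E z) = 0" by (metis vector_matrix_mul_assoc vector_matrix_mult_0)
  hence "K' z = K z" by (simp add: Delta_mult_inverse z)
  hence "cnj (K (cnj z) $ j) = K z $ j" by (simp add: K'_def cv_def vec_eq_iff)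
  thus ?thesis by (metis complex_cnj_cnj)
qed

lemma Kfilt_rational:
  obtains d :: "complex poly" and N :: "'y \<Rightarrow> complex poly"
  where "degree d = m + CARD('n)" "lead_coeff d = 1" "\<And>z. poly d z = 0 \<Longrightarrow> cmod z < 1"
    "\<And>z. poly d (cnj z) = cnj (poly d z)" "\<And>j. degree (N j) \<le> degree d"
    "\<And>z j. cmod z = 1 \<Longrightarrow> K z $ j = poly (N j) z / poly d z"
proof -
  obtain a h c where a: "det (pencil A B Cy) = a * h" "degree a = CARD('n)" "lead_coeff a = 1"
    "\<And>z. poly a z = 0 \<Longrightarrow> cmod z < 1" "\<And>z. cmod z \<le> 1 \<Longrightarrow> poly h z \<noteq> 0"
    "\<And>z. poly a (cnj z) = cnj (poly a z)"
    by (rule self_reciprocal_factorization[OF degree_det_pencil[of A B Cy] det_pencil_reciprocal[of _ A B Cy]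
        det_pencil_nonzero[OF det ctrb] det_pencil_cnj[of A B Cy]])
      (assumption, assumption, rule that, assumption+)
  obtain b hp cp where b: "degree b = m" "lead_coeff b = 1" "\<And>z. poly b z = 0 \<Longrightarrow> cmod z < 1"
    "\<And>z. cmod z \<le> 1 \<Longrightarrow> poly hp z \<noteq> 0" "\<And>z. poly b (cnj z) = cnj (poly b z)"
    "\<And>z. cmod z = 1 \<Longrightarrow> z ^ m * lpoly p m z = poly b z * poly hp z"
    by (rule laurent_factorization[OF p_sym P_pos]) (rule that, assumption+)
  obtain e hq cq where e: "\<And>z. poly e z = 0 \<Longrightarrow> cmod z < 1" "\<And>z. cmod z \<le> 1 \<Longrightarrow> poly hq z \<noteq> 0"
    "\<And>z. cmod z = 1 \<Longrightarrow> z ^ m * lpoly q m z = poly e z * poly hq z"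
    by (rule laurent_factorization[OF q_sym Q_pos]) (rule that, assumption+)
  define d where "d = b * a"
  have deg: "degree d = m + CARD('n)"
    using a(2,3) b(1,2) unfolding d_def by (subst degree_mult_eq) auto
  obtain S where S: "vwiener {1..} S" "vwiener {..0} K"
    "\<And>z. cmod z = 1 \<Longrightarrow> K z = cvec Cs v* Xi z - (inverse (U z) *s S z) v* E z"
    by (rule Kfilt_decomposition) (rule that, assumption+)
  have az: "poly a z \<noteq> 0" "poly b z \<noteq> 0" "poly e z \<noteq> 0" if "cmod z = 1" for z
    using that a(4)[of z] b(3)[of z] e(1)[of z] by auto
  \<comment> \<open>\<open>a\<close> cancels against the determinant \<open>a * h\<close>; the
    remaining \<open>h\<close> has its roots outside the closed disc.\<close>
  have aXi: "mwiener {0..} (\<lambda>z. mat (poly a z) ** Xi z)"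
    unfolding mwiener_def mat_mult_component
  proof (intro allI)
    fix i k
    have "wiener {0..} (\<lambda>z. poly (pencil_num A B Cy i k) z * inverse (poly h z))"
      by (rule wiener_mult[OF wiener_poly_atLeast wiener_inverse_poly_outer]) (use a(5) in auto)
    thus "wiener {0..} (\<lambda>z. poly a z * Xi z $ i $ k)"
      by (rule wiener_cong) (use az in \<open>simp add: pencil_sol_def a(1) field_simps\<close>)
  qed
  have "mwiener {0..} (\<lambda>z. cmat Cy ** (mat (poly a z) ** Xi z))"
    by (rule mwiener_mult[OF mwiener_const[of "{0..}"] aXi]) auto
  hence aR: "mwiener {0..} (\<lambda>z. mat (poly a z) ** R z)"
    unfolding matrix_diff_ldistrib mat_mult_commute[of _ "cmat Cy"] matrix_mul_rid
    by (rule mwiener_diff[OF mwiener_mat[OF wiener_poly_atLeast]])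
  have "mwiener {0..} (\<lambda>z. adj (D z) ** (mat (poly a z) ** R z))"
    by (rule mwiener_mult[OF mwiener_adj[OF mwiener_D, of "{0..}"] aR]) auto
  hence aE: "mwiener {0..} (\<lambda>z. mat (poly a z) ** E z)"
    by (rule mwiener_cong) (simp add: inverse_Delta_eq mat_mult_commute)
  \<comment> \<open>\<open>inverse U\<close> equals \<open>cnj U\<close> times \<open>Q/P\<close>,
    in which the powers \<open>z ^ m\<close> cancel. Of the four factors only \<open>b\<close> and
    \<open>hp\<close> are denominators: \<open>b\<close> is multiplied away, and \<open>hp\<close>
    has an anticausal inverse.\<close>
  have bU: "wiener {0..} (\<lambda>z. poly b z * inverse (U z))"
  proof (rule wiener_cong)
    show "wiener {0..} (\<lambda>z. cnj (U z) * (poly e z * (poly hq z * inverse (poly hp z))))"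
      by (rule wiener_mult[OF wiener_cnj[OF U_wiener(1), of "{0..}"]
            wiener_mult[where R = "{0..}", OF wiener_poly_atLeast
              wiener_mult[where R = "{0..}", OF wiener_poly_atLeast wiener_inverse_poly_outer]]])
         (use b(4) in auto)
    fix z :: complex assume z: "cmod z = 1"
    have nz: "z \<noteq> 0" "poly hp z \<noteq> 0" "poly hq z \<noteq> 0" "U z \<noteq> 0"
      using z b(4)[of z] e(2)[of z] U_wiener(3)[OF z] by auto
    have "lpoly q m z \<noteq> 0" using Q_pos z by force
    have "cnj (U z) * U z = lpoly p m z / lpoly q m z"
      using U(2) z by (simp add: canonical_U_def)
    also have "\<dots> = (z ^ m * lpoly p m z) / (z ^ m * lpoly q m z)" using nz by simp
    also have "\<dots> = (poly b z * poly hp z) / (poly e z * poly hq z)"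
      by (simp only: b(6)[OF z] e(3)[OF z])
    finally show "cnj (U z) * (poly e z * (poly hq z * inverse (poly hp z))) = poly b z * inverse (U z)"
      using nz az[OF z] by (simp add: field_simps)
  qed
  have 1: "wiener {..int (degree d)} (\<lambda>z. poly d z * K z $ j)" for j
    by (rule wiener_mult[OF wiener_poly_atMost]) (use S(2) in \<open>auto simp: vwiener_def\<close>)
  have 2: "wiener {0..} (\<lambda>z. poly d z * K z $ j)" for j
  proof -
    \<comment> \<open>In \<open>d = b * a\<close> the factor \<open>a\<close> is spent on
      \<open>Xi\<close> and on \<open>E\<close>, the factor \<open>b\<close> on
      \<open>inverse U\<close>.\<close>
    have "vwiener {0..} (\<lambda>z. poly b z *s (cvec Cs v* (mat (poly a z) ** Xi z)))"
      by (rule vwiener_smult[OF wiener_poly_atLeast vwiener_mult[OF vwiener_const[of "{0..}"] aXi, of "{0..}"]]) auto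
    moreover have "vwiener {0..} (\<lambda>z. ((poly b z * inverse (U z)) *s S z) v* (mat (poly a z) ** E z))"
      by (rule vwiener_mult[OF vwiener_smult[OF bU S(1), of "{0..}"] aE]) auto
    ultimately have "vwiener {0..} (\<lambda>z. poly b z *s (cvec Cs v* (mat (poly a z) ** Xi z)) -
      ((poly b z * inverse (U z)) *s S z) v* (mat (poly a z) ** E z))"
      by (rule vwiener_diff)
    hence "vwiener {0..} (\<lambda>z. poly d z *s K z)"
      by (rule vwiener_cong)
         (simp only: S(3) smult_vector_matrix_mult vector_matrix_mult_mat d_def poly_mult,
          simp add: vec_eq_iff algebra_simps)
    thus ?thesis by (simp add: vwiener_def)
  qed
  have "\<exists>N. degree N \<le> degree d \<and> (\<forall>z. cmod z = 1 \<longrightarrow> poly d z * K z $ j = poly N z)" for j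
  proof -
    have "wiener {0..int (degree d)} (\<lambda>z. poly d z * K z $ j)"
      using wiener_Int[OF 1 2] by (rule wiener_mono) auto
    thus ?thesis by (rule wiener_polynomial) blast
  qed
  then obtain N where N: "\<And>j. degree (N j) \<le> degree d"
    "\<And>z j. cmod z = 1 \<Longrightarrow> poly d z * K z $ j = poly (N j) z" by metis
  show ?thesis
  proof (rule that[of d N])
    show "lead_coeff d = 1" using a(3) b(2) by (simp add: d_def lead_coeff_mult)
    show "cmod z < 1" if "poly d z = 0" for z using that a(4) b(3) by (auto simp: d_def)
    show "poly d (cnj z) = cnj (poly d z)" for z by (simp add: d_def a(6) b(5))
    show "K z $ j = poly (N j) z / poly d z" if "cmod z = 1" for z j
      using N(2)[OF that, of j] az[OF that] by (simp add: d_def field_simps)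
  qed (use deg N in auto)
qed

end

theorem theorem4p6:
  fixes A :: "real^'n^'n" and B :: "real^'w^'n" and Cy :: "real^'n^'y" and Cs :: "real^'n"
    and D :: "complex \<Rightarrow> complex^'y^'y"
    and p q :: "int \<Rightarrow> real" and m :: nat
  assumes detA_Cy: "detectable A Cy"
    and detA_Cs: "detectable_row A Cs"
    and ctrb: "controllable A B"
    and Delta: "canonical_Delta A B Cy D"
    and p_sym: "\<forall>k. p (- k) = p k"
    and q_sym: "\<forall>k. q (- k) = q k"
    and P_pos: "\<forall>z. cmod z = 1 \<longrightarrow> Re (lpoly p m z) > 0"
    and Q_pos: "\<forall>z. cmod z = 1 \<longrightarrow> Re (lpoly q m z) > 0"
    and card_r: "CARD('r) = m + CARD('n)"
  shows "(\<exists>U. ratfun U \<and> canonical_U p q m U) \<and>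
         (\<forall>U. ratfun U \<and> canonical_U p q m U \<longrightarrow>
            vratfun (Kfilt A B Cy Cs D U) \<and>
            (\<exists>(F :: real^'r^'r) (G :: real^'y^'r) (H :: real^'r) (L :: real^'y).
                schur_stable F \<and>
                (\<forall>z. cmod z = 1 \<longrightarrow> Kfilt A B Cy Cs D U z = ss_tf F G H L z)))"
proof (intro conjI allI impI)
  show "\<exists>U. ratfun U \<and> canonical_U p q m U"
    using canonical_U_exists[OF p_sym P_pos q_sym Q_pos] .
next
  fix U assume "ratfun U \<and> canonical_U p q m U"
  hence U: "ratfun U" "canonical_U p q m U" by auto
  let ?K = "Kfilt A B Cy Cs D U"
  note ctxt = detA_Cy ctrb Delta p_sym q_sym P_pos Q_pos U
  obtain d :: "complex poly" and N :: "'y \<Rightarrow> complex poly"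
    where d: "degree d = m + CARD('n)" "lead_coeff d = 1" "\<And>z. poly d z = 0 \<Longrightarrow> cmod z < 1"
    "\<And>z. poly d (cnj z) = cnj (poly d z)" "\<And>j. degree (N j) \<le> degree d"
    and K: "\<And>z j. cmod z = 1 \<Longrightarrow> ?K z $ j = poly (N j) z / poly d z"
    using Kfilt_rational[OF ctxt] by metis
  have dz: "poly d z \<noteq> 0" if "cmod z = 1" for z using d(3)[of z] that by auto
  show "vratfun ?K"
    unfolding vratfun_def ratfun_def using K dz by blast
  \<comment> \<open>On the circle \<open>N j\<close> is the product of the filter entry and
    \<open>d\<close>, both of which commute with conjugation.\<close>
  have "poly (N j) (cnj z) = cnj (poly (N j) z)" if z: "cmod z = 1" for j z
  proof -
    have "poly (N j) w = ?K w $ j * poly d w" if "cmod w = 1" for w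
      using K[OF that] dz[OF that] by simp
    thus ?thesis using z by (simp add: Kfilt_cnj[OF ctxt z] d(4))
  qed
  hence "\<exists>q :: real poly. N j = map_poly of_real q \<and> degree q = degree (N j)" for j
    by (metis real_poly_of_cnj)
  then obtain n :: "'y \<Rightarrow> real poly" where n: "\<And>j. N j = map_poly of_real (n j)" "\<And>j. degree (n j) = degree (N j)"
    by metis
  obtain d' :: "real poly" where d': "d = map_poly of_real d'" "degree d' = degree d"
    using real_poly_of_cnj[of d] d(4) by metis
  have lead: "lead_coeff d' = 1"
    using d(2) d' by (simp add: coeff_map_poly)
  obtain F :: "real^'r^'r" and G :: "real^'y^'r" and H L where
    F: "schur_stable F" and tf: "\<And>z j. cmod z = 1 \<Longrightarrow>
      ss_tf F G H L z $ j = poly (map_poly of_real (n j)) z / poly (map_poly of_real d') z"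
    by (rule companion_realization[of d' n, where 'r = 'r])
       (use card_r d d' lead n in auto)
  have "?K z = ss_tf F G H L z" if "cmod z = 1" for z
    using K[OF that] tf[OF that] by (simp add: vec_eq_iff n(1) d'(1))
  thus "\<exists>(F :: real^'r^'r) (G :: real^'y^'r) (H :: real^'r) (L :: real^'y).
      schur_stable F \<and> (\<forall>z. cmod z = 1 \<longrightarrow> ?K z = ss_tf F G H L z)"
    using F by blast
qed

end
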